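(* Let $\{\psi_j\}_{j=1}^\infty$ be a frame for $\mathcal{H}$ with frame bounds $A,B>0$ and frame operator $S$, and suppose there are constants $c_0>0$ and $s>1$ such that $|\langle \psi_j,\psi_l\rangle|\le c_0(1+|j-l|)^{-s}$ for all $j,l\in\mathbb{N}$. Let $f\in\mathcal{H}$ satisfy $|\langle f,\psi_j\rangle|\le c' j^{-s}$ for all $j\in\mathbb{N}$ and some constant $c'>0$. For each $n\in\mathbb{N}$ choose $$m=m(n)=n+\left\lceil\left[\frac{2c_0^2\,n}{A(2s-1)\lambda_{\min}(\Psi_n)}\right]^{\frac{1}{2s-1}}\right\rceil .$$ Then there exists a constant $c>0$, independent of $n$, such that for all $n\in\mathbb{N}$ $$\|S^{-1}f-V_n^{-1}P_nf\|\le c\,n^{-(s-1/2)}.$$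
   Context: $\mathcal{H}$ is a separable Hilbert space. A sequence $\{\psi_j\}_{j=1}^\infty\subset\mathcal H$ is a frame with bounds $A,B>0$ if $A\|f\|^2\le\sum_{j=1}^\infty|\langle f,\psi_j\rangle|^2\le B\|f\|^2$ for all $f\in\mathcal{H}$; its frame operator is $Sf=\sum_{j=1}^\infty\langle f,\psi_j\rangle\psi_j$, which is bounded and invertible. For $n\in\mathbb{N}$, $\mathcal{H}_n=\mathrm{span}\{\psi_j:1\le j\le n\}$, $P_n$ is the orthogonal projection of $\mathcal{H}$ onto $\mathcal{H}_n$, $S_mf=\sum_{j=1}^m\langle f,\psi_j\rangle\psi_j$, and $V_n=P_nS_m|_{\mathcal{H}_n}:\mathcal{H}_n\to\mathcal{H}_n$. $\Psi_n=[\langle\psi_j,\psi_l\rangle]_{j,l=1}^n$ is the Gram matrix and $\lambda_{\min}(\Psi_n)$ its smallest eigenvalue; it is assumed that $\Psi_n$ is invertible for every $n$. *)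

theory Defs
  imports "HOL-Analysis.Analysis" "Jordan_Normal_Form.Char_Poly"
begin

(* The scalar field of a Hilbert space. Its axioms hold for the real and the complex numbers with
   their usual conjugation and absolute value, and for no other field: every x is a root of the
   real quadratic (X - x) * (X - cnjg x), and a real normed field that is algebraic over the reals
   is isometrically one of these two. *)
class hilbert_scalar = real_normed_field + heine_borel +
  fixes cnjg :: "'a \<Rightarrow> 'a"
  assumes cnjg_add: "cnjg (x + y) = cnjg x + cnjg y"
    and cnjg_mult: "cnjg (x * y) = cnjg x * cnjg y"
    and cnjg_cnjg: "cnjg (cnjg x) = x"
    and mult_cnjg: "x * cnjg x = (norm x)\<^sup>2 *\<^sub>R 1"

instantiation real :: hilbert_scalar
begin
definition cnjg_real :: "real \<Rightarrow> real" where "cnjg_real x = x"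
instance by standard (auto simp: cnjg_real_def power2_eq_square)
end

instantiation complex :: hilbert_scalar
begin
definition cnjg_complex :: "complex \<Rightarrow> complex" where "cnjg_complex z = cnj z"
instance by standard
  (auto simp: cnjg_complex_def scaleR_conv_of_real complex_norm_square simp flip: of_real_power)
end

(* A separable Hilbert space over 'k. Completeness and separability are sorts of the type of
   vectors; the inner product ip is linear in its first argument and induces the norm. The sort of
   'a brings along a multiplication by real scalars, which has to be the restriction of smul. *)
locale hilbert_space = vector_space smul
  for smul :: "'k::hilbert_scalar \<Rightarrow> 'a::{banach, second_countable_topology} \<Rightarrow> 'a" +
  fixes ip :: "'a \<Rightarrow> 'a \<Rightarrow> 'k"
  assumes smul_of_real: "smul (of_real r) x = r *\<^sub>R x"
    and ip_add_left: "ip (x + y) z = ip x z + ip y z"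
    and ip_smul_left: "ip (smul a x) y = a * ip x y"
    and ip_commute: "ip y x = cnjg (ip x y)"
    and ip_self: "ip x x = of_real ((norm x)\<^sup>2)"

lemma hilbert_space_real:
  "hilbert_space (\<lambda>(r::real) (x::'a::{real_inner, banach, second_countable_topology}). r *\<^sub>R x) inner"
  by unfold_locales
     (auto simp: algebra_simps cnjg_real_def inner_commute power2_norm_eq_inner)

lemma hilbert_space_complex:
  "hilbert_space ((*) :: complex \<Rightarrow> complex \<Rightarrow> complex) (\<lambda>x y. x * cnj y)"
  by unfold_locales
     (auto simp: algebra_simps cnjg_complex_def scaleR_conv_of_real complex_norm_square
       simp flip: of_real_power)

(* A sequence (psi_j) with j = 1, 2, ... is a function psi on the naturals whose value at 0 plays no
   role; accordingly the series below run over psi (Suc j) with j = 0, 1, ... *)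

definition is_frame :: "('a::real_normed_vector \<Rightarrow> 'a \<Rightarrow> 'k::real_normed_field) \<Rightarrow> (nat \<Rightarrow> 'a) \<Rightarrow> real \<Rightarrow> real \<Rightarrow> bool"
  where "is_frame ip \<psi> A B \<longleftrightarrow> A > 0 \<and> B > 0 \<and>
    (\<forall>f. summable (\<lambda>j. (norm (ip f (\<psi> (Suc j))))\<^sup>2) \<and>
         A * (norm f)\<^sup>2 \<le> (\<Sum>j. (norm (ip f (\<psi> (Suc j))))\<^sup>2) \<and>
         (\<Sum>j. (norm (ip f (\<psi> (Suc j))))\<^sup>2) \<le> B * (norm f)\<^sup>2)"

definition frame_operator :: "('k \<Rightarrow> 'a \<Rightarrow> 'a) \<Rightarrow> ('a::real_normed_vector \<Rightarrow> 'a \<Rightarrow> 'k) \<Rightarrow> (nat \<Rightarrow> 'a) \<Rightarrow> 'a \<Rightarrow> 'a"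
  where "frame_operator smul ip \<psi> f = (\<Sum>j. smul (ip f (\<psi> (Suc j))) (\<psi> (Suc j)))"

definition partial_frame_operator :: "('k \<Rightarrow> 'a \<Rightarrow> 'a) \<Rightarrow> ('a::real_normed_vector \<Rightarrow> 'a \<Rightarrow> 'k) \<Rightarrow> (nat \<Rightarrow> 'a) \<Rightarrow> nat \<Rightarrow> 'a \<Rightarrow> 'a"
  where "partial_frame_operator smul ip \<psi> m f = (\<Sum>j=1..m. smul (ip f (\<psi> j)) (\<psi> j))"

definition section_space :: "('k::field \<Rightarrow> 'a \<Rightarrow> 'a) \<Rightarrow> (nat \<Rightarrow> 'a::ab_group_add) \<Rightarrow> nat \<Rightarrow> 'a set"
  where "section_space smul \<psi> n = module.span smul (\<psi> ` {1..n})"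

definition orth_proj :: "('a::ab_group_add \<Rightarrow> 'a \<Rightarrow> 'k::zero) \<Rightarrow> 'a set \<Rightarrow> 'a \<Rightarrow> 'a"
  where "orth_proj ip M f = (THE p. p \<in> M \<and> (\<forall>g\<in>M. ip (f - p) g = 0))"

(* V_n = P_n S_m; its restriction to H_n is made explicit where it is inverted. *)
definition section_operator :: "('k::field \<Rightarrow> 'a \<Rightarrow> 'a) \<Rightarrow> ('a::real_normed_vector \<Rightarrow> 'a \<Rightarrow> 'k) \<Rightarrow> (nat \<Rightarrow> 'a) \<Rightarrow> nat \<Rightarrow> nat \<Rightarrow> 'a \<Rightarrow> 'a"
  where "section_operator smul ip \<psi> n m g =
    orth_proj ip (section_space smul \<psi> n) (partial_frame_operator smul ip \<psi> m g)"

definition gram_matrix :: "('a \<Rightarrow> 'a \<Rightarrow> 'k) \<Rightarrow> (nat \<Rightarrow> 'a) \<Rightarrow> nat \<Rightarrow> 'k Matrix.mat"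
  where "gram_matrix ip \<psi> n = Matrix.mat n n (\<lambda>(j, l). ip (\<psi> (Suc j)) (\<psi> (Suc l)))"

(* Meant for Hermitian matrices, all of whose eigenvalues are real. *)
definition lambda_min :: "'k::real_normed_field Matrix.mat \<Rightarrow> real"
  where "lambda_min G = Min {r::real. eigenvalue G (of_real r)}"

end

theory Submission
  imports Defs
begin

text \<open>
  Write \<open>g = S\<inverse> f\<close>, and let \<open>T h\<close> be the sequence of the \<open>\<langle>h, \<psi>\<^sub>j\<rangle>\<close>, so that \<open>S = T\<^sup>* T\<close> and the Gram operator is
  \<open>G = T T\<^sup>*\<close>. The choice of \<open>m\<close> makes the energy \<open>\<Sum>j>m. \<bar>\<langle>h, \<psi>\<^sub>j\<rangle>\<bar>\<^sup>2\<close> of every \<open>h \<in> H\<^sub>n\<close> at most \<open>A / 2 \<parallel>h\<parallel>\<^sup>2\<close>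
  (\<open>section_tail_bound\<close>): the entries of \<open>G\<close> decay away from the diagonal, and the coefficients of \<open>h\<close>
  with respect to \<open>\<psi>\<^sub>1, ..., \<psi>\<^sub>n\<close> are controlled by the smallest eigenvalue of the Gram matrix, which is
  the minimum of the Rayleigh quotient. Hence \<open>\<langle>V\<^sub>n h, h\<rangle> \<ge> A / 2 \<parallel>h\<parallel>\<^sup>2\<close>, so \<open>V\<^sub>n\<close> is invertible on \<open>H\<^sub>n\<close> and
  \<open>\<parallel>V\<^sub>n\<inverse>\<parallel> \<le> 2 / A\<close>. From \<open>V\<^sub>n (P\<^sub>n g - V\<^sub>n\<inverse> P\<^sub>n f) = P\<^sub>n (S\<^sub>m (P\<^sub>n g - g) + (S\<^sub>m - S) g)\<close> the error is at most a
  constant times the tail of \<open>T g\<close> beyond \<open>m\<close> plus the distance from \<open>g\<close> to \<open>H\<^sub>n\<close>; since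
  \<open>g = T\<^sup>* T (S\<inverse> g)\<close>, that distance is at most a constant times the tail of \<open>T (S\<inverse> g)\<close> beyond \<open>n\<close>
  (\<open>finite_section_error\<close>).

  It remains to show that the \<open>l\<^sup>2\<close> tails of \<open>T (S\<inverse> f)\<close> and \<open>T (S\<inverse> (S\<inverse> f))\<close> decay like \<open>n powr (1 / 2 - s)\<close>,
  as those of \<open>T f\<close> do. This is a form of Jaffard's theorem for the pseudo-inverse of \<open>G\<close>, but only at
  the level of tails, which has a direct proof. Multiply by a cutoff \<open>\<omega>\<close> that rises slowly from 0 to
  1 between \<open>2 N\<close> and \<open>4 N\<close>. As \<open>S\<close> is bounded below, the norm of \<open>\<omega> T S h\<close> is bounded by that of \<open>\<omega> T S S h\<close>
  up to the norms of the commutators \<open>[\<omega>, G] T S h\<close> and \<open>[\<omega>, G] T h\<close> (\<open>cutoff_estimate\<close>); only \<open>S\<close>, not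
  the possibly singular \<open>G\<close>, is inverted. The commutators gain a power \<open>N powr (- \<delta>)\<close> over the decay
  already known (\<open>comm_ramp_bound\<close>). Applying this to all iterated preimages of \<open>f\<close> simultaneously
  raises the decay exponent step by step from 0 to \<open>s - 1 / 2\<close>
  (\<open>tail_decay_inverse_frame_operator\<close>).
\<close>

section \<open>Hilbert spaces over an abstract scalar field\<close>

lemma cnjg_zero [simp]: "cnjg (0::'k::hilbert_scalar) = 0"
  using cnjg_add[of "0::'k" 0] by simp

lemma cnjg_uminus: "cnjg (- x) = - cnjg (x::'k::hilbert_scalar)"
  using cnjg_add[of x "- x"] by (simp add: eq_neg_iff_add_eq_0 add.commute)

lemma cnjg_diff: "cnjg (x - y) = cnjg x - cnjg (y::'k::hilbert_scalar)"
  using cnjg_add[of x "- y"] by (simp add: cnjg_uminus)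

lemma cnjg_sum: "cnjg (\<Sum>i\<in>I. g i) = (\<Sum>i\<in>I. cnjg (g i :: 'k::hilbert_scalar))"
  by (induction I rule: infinite_finite_induct) (auto simp: cnjg_add)

lemma mult_cnjg_of_real: "x * cnjg x = (of_real ((norm x)\<^sup>2) :: 'k::hilbert_scalar)"
  by (simp add: mult_cnjg of_real_def)

lemma cnjg_of_real [simp]: "cnjg (of_real r) = (of_real r :: 'k::hilbert_scalar)"
proof (cases "r = 0")
  case False
  have "of_real r * cnjg (of_real r) = (of_real r * of_real r :: 'k)"
    unfolding mult_cnjg_of_real by (simp add: power2_eq_square)
  with False show ?thesis by simp
qed simp

lemma norm_cnjg [simp]: "norm (cnjg x) = norm (x :: 'k::hilbert_scalar)"
proof (cases "x = 0")
  case False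
  have "norm (x * cnjg x) = norm x * norm x"
    unfolding mult_cnjg_of_real norm_of_real by (simp add: power2_eq_square)
  with False show ?thesis by (simp add: norm_mult)
qed simp

context hilbert_space
begin

lemma ip_zero_left [simp]: "ip 0 y = 0"
  using ip_smul_left[of 0 0 y] by simp

lemma ip_add_right: "ip x (y + z) = ip x y + ip x z"
  by (metis cnjg_add ip_add_left ip_commute)

lemma ip_smul_right: "ip x (smul a y) = cnjg a * ip x y"
  by (metis cnjg_mult ip_smul_left ip_commute)

lemma ip_zero_right [simp]: "ip x 0 = 0"
  using ip_commute[of x 0] by simp

lemma ip_uminus_left: "ip (- x) y = - ip x y"
  using ip_add_left[of x "- x" y] by (simp add: eq_neg_iff_add_eq_0 add.commute)

lemma ip_diff_left: "ip (x - y) z = ip x z - ip y z"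
  using ip_add_left[of x "- y" z] by (simp add: ip_uminus_left)

lemma ip_diff_right: "ip x (y - z) = ip x y - ip x z"
  by (metis cnjg_diff ip_diff_left ip_commute)

lemma ip_sum_left: "ip (\<Sum>i\<in>I. g i) y = (\<Sum>i\<in>I. ip (g i) y)"
  by (induction I rule: infinite_finite_induct) (auto simp: ip_add_left)

lemma ip_scaleR_left: "ip (r *\<^sub>R x) y = r *\<^sub>R ip x y"
  by (simp add: smul_of_real[symmetric] ip_smul_left scaleR_conv_of_real)

lemma ip_scaleR_right: "ip x (r *\<^sub>R y) = r *\<^sub>R ip x y"
  by (simp add: smul_of_real[symmetric] ip_smul_right scaleR_conv_of_real)

lemma norm_ip_self: "norm (ip x x) = (norm x)\<^sup>2"
  unfolding ip_self norm_of_real by simp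

lemma norm_ip_commute: "norm (ip x y) = norm (ip y x)"
  by (metis ip_commute norm_cnjg)

lemma norm_smul: "norm (smul a x) = norm a * norm x"
proof -
  have "(norm (smul a x))\<^sup>2 = norm (ip (smul a x) (smul a x))"
    by (simp only: norm_ip_self)
  also have "\<dots> = (norm a * norm x)\<^sup>2"
    by (simp add: ip_smul_left ip_smul_right norm_mult norm_ip_self power2_eq_square)
  finally show ?thesis
    by (meson mult_nonneg_nonneg norm_ge_zero power2_eq_imp_eq)
qed

lemma Cauchy_Schwarz: "norm (ip x y) \<le> norm x * norm y"
proof (cases "y = 0")
  case False
  define b where "b = ip x y"
  define t where "t = 1 / (norm y)\<^sup>2"
  have t: "t * (norm y)\<^sup>2 = 1" "t > 0" using False by (auto simp: t_def)
  \<comment> \<open>The component of \<open>x\<close> orthogonal to \<open>y\<close>; its squared norm is nonnegative.\<close>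
  define w where "w = x - smul (of_real t * b) y"
  have b': "ip y x = cnjg b" by (simp add: b_def ip_commute[of y x])
  have "of_real ((norm w)\<^sup>2) = ip w w" by (simp only: ip_self)
  also have "\<dots> = ip x x - cnjg (of_real t * b) * b - of_real t * b * cnjg b
      + of_real t * b * (cnjg (of_real t * b) * ip y y)"
    by (simp add: w_def ip_diff_left ip_diff_right ip_smul_left ip_smul_right b'
        b_def[symmetric] algebra_simps)
  also have "\<dots> = of_real ((norm x)\<^sup>2) - of_real t * (b * cnjg b) - of_real t * (b * cnjg b)
      + of_real t * (of_real t * of_real ((norm y)\<^sup>2)) * (b * cnjg b)"
    by (simp add: ip_self cnjg_mult algebra_simps)
  also have "\<dots> = of_real ((norm x)\<^sup>2 - t * (norm b)\<^sup>2)"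
    unfolding mult_cnjg_of_real of_real_mult[symmetric] t
    by (simp only: mult_1_right of_real_mult of_real_diff) (simp add: algebra_simps)
  finally have "(norm w)\<^sup>2 = (norm x)\<^sup>2 - t * (norm b)\<^sup>2"
    by (simp only: of_real_eq_iff)
  then have "t * (norm b)\<^sup>2 \<le> (norm x)\<^sup>2"
    using zero_le_power2[of "norm w"] by linarith
  then have "t * (norm b)\<^sup>2 * (norm y)\<^sup>2 \<le> (norm x)\<^sup>2 * (norm y)\<^sup>2"
    by (rule mult_right_mono) simp
  then have "(norm b)\<^sup>2 * (t * (norm y)\<^sup>2) \<le> (norm x * norm y)\<^sup>2"
    by (simp add: power_mult_distrib mult.commute mult.left_commute)
  then have "(norm b)\<^sup>2 \<le> (norm x * norm y)\<^sup>2"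
    by (simp only: t mult_1_right)
  then show ?thesis
    unfolding b_def by (meson mult_nonneg_nonneg norm_ge_zero power2_le_imp_le)
qed simp

lemma bounded_linear_ip: "bounded_linear (\<lambda>x. ip x y)"
  by (rule bounded_linear_intro[where K = "norm y"])
     (auto simp: ip_add_left ip_scaleR_left Cauchy_Schwarz)

lemma ip_self_eq_0: "ip x x = 0 \<longleftrightarrow> x = 0"
  using norm_ip_self[of x] by auto

lemma subspace_perp: "subspace {h. ip x h = 0}"
  by (auto simp: subspace_def ip_add_right ip_smul_right)

text \<open>Induction on the spanning set, with one Gram-Schmidt step for each new vector.\<close>

lemma projection_exists:
  assumes "finite F"
  shows "\<exists>p\<in>span F. \<forall>g\<in>span F. ip (x - p) g = 0"
  using assms
proof (induction F arbitrary: x)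
  case empty
  then show ?case by auto
next
  case (insert v F)
  obtain q where q: "q \<in> span F" "\<And>g. g \<in> span F \<Longrightarrow> ip (v - q) g = 0"
    using insert.IH by blast
  obtain p where p: "p \<in> span F" "\<And>g. g \<in> span F \<Longrightarrow> ip (x - p) g = 0"
    using insert.IH by blast
  define w where "w = v - q"
  define a where "a = ip (x - p) w / ip w w"
  let ?M = "span (insert v F)"
  have F: "span F \<subseteq> ?M" by (intro span_mono) auto
  have w: "w \<in> ?M" 
    unfolding w_def using F q(1) by (intro span_diff) (auto intro: span_base)
  have orth_w: "ip (x - (p + smul a w)) w = 0"
    by (cases "w = 0") (auto simp: a_def ip_diff_left ip_add_left ip_smul_left ip_self_eq_0)
  have orth_F: "ip (x - (p + smul a w)) g = 0" if "g \<in> span F" for g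
    using p(2)[OF that] q(2)[OF that]
    by (simp add: ip_diff_left ip_add_left ip_smul_left w_def)
  have "insert v F \<subseteq> {h. ip (x - (p + smul a w)) h = 0}"
  proof
    fix h assume "h \<in> insert v F"
    then consider "h = w + q" | "h \<in> F" by (auto simp: w_def)
    then show "h \<in> {h. ip (x - (p + smul a w)) h = 0}"
      using orth_w orth_F[OF q(1)] orth_F[OF span_base] by cases (auto simp: ip_add_right)
  qed
  then have "?M \<subseteq> {h. ip (x - (p + smul a w)) h = 0}"
    by (intro span_minimal subspace_perp)
  moreover have "p + smul a w \<in> ?M"
    using p(1) F w by (intro span_add span_scale) auto
  ultimately show ?case by (intro bexI[of _ "p + smul a w"]) auto
qed

lemma orth_proj_props:
  assumes "finite F" and M: "M = span F"
  shows "orth_proj ip M x \<in> M" and "g \<in> M \<Longrightarrow> ip (x - orth_proj ip M x) g = 0"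
proof -
  have sub: "subspace M" unfolding M by (rule subspace_span)
  have "\<exists>!p. p \<in> M \<and> (\<forall>g\<in>M. ip (x - p) g = 0)"
  proof (rule ex_ex1I)
    show "\<exists>p. p \<in> M \<and> (\<forall>g\<in>M. ip (x - p) g = 0)"
      using projection_exists[OF assms(1), of x] M by auto
    fix p q assume p: "p \<in> M \<and> (\<forall>g\<in>M. ip (x - p) g = 0)"
      and q: "q \<in> M \<and> (\<forall>g\<in>M. ip (x - q) g = 0)"
    have "p - q \<in> M" using p q sub by (simp add: subspace_diff)
    then have "ip (x - q) (p - q) - ip (x - p) (p - q) = 0" using p q by simp
    then have "ip (p - q) (p - q) = 0" by (simp add: ip_diff_left)
    then show "p = q" by (simp add: ip_self_eq_0)
  qed
  from theI'[OF this] show "orth_proj ip M x \<in> M"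
    and "g \<in> M \<Longrightarrow> ip (x - orth_proj ip M x) g = 0"
    unfolding orth_proj_def by auto
qed

lemma orth_proj_unique:
  assumes "finite F" and M: "M = span F"
    and "p \<in> M" and "\<And>g. g \<in> M \<Longrightarrow> ip (x - p) g = 0"
  shows "orth_proj ip M x = p"
proof -
  note P = orth_proj_props[OF assms(1,2), where x = x]
  define d where "d = p - orth_proj ip M x"
  have d: "d \<in> M" unfolding d_def using P(1) assms(3) M by (simp add: span_diff)
  have "ip (x - orth_proj ip M x) d - ip (x - p) d = 0"
    using P(2)[OF d] assms(4)[OF d] by simp
  then have "ip d d = 0" by (simp add: ip_diff_left d_def)
  then show ?thesis by (simp add: ip_self_eq_0 d_def)
qed

lemma orth_proj_add:
  assumes "finite F" and M: "M = span F"
  shows "orth_proj ip M (x + y) = orth_proj ip M x + orth_proj ip M y"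
proof (rule orth_proj_unique[OF assms])
  note P = orth_proj_props[OF assms]
  show "orth_proj ip M x + orth_proj ip M y \<in> M" using P(1) M by (simp add: span_add)
  fix g assume "g \<in> M"
  from P(2)[OF this, of x] P(2)[OF this, of y]
  show "ip (x + y - (orth_proj ip M x + orth_proj ip M y)) g = 0"
    by (simp add: ip_diff_left ip_add_left)
qed

lemma orth_proj_smul:
  assumes "finite F" and M: "M = span F"
  shows "orth_proj ip M (smul a x) = smul a (orth_proj ip M x)"
proof (rule orth_proj_unique[OF assms])
  note P = orth_proj_props[OF assms]
  show "smul a (orth_proj ip M x) \<in> M" using P(1) M by (simp add: span_scale)
  fix g assume "g \<in> M"
  from P(2)[OF this, of x]
  show "ip (smul a x - smul a (orth_proj ip M x)) g = 0"
    by (simp add: ip_diff_left ip_smul_left)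
qed

lemma orth_proj_norm_le:
  assumes "finite F" and M: "M = span F"
  shows "norm (orth_proj ip M x) \<le> norm x"
proof -
  note P = orth_proj_props[OF assms]
  let ?p = "orth_proj ip M x"
  have "ip x ?p = ip ?p ?p" using P(2)[OF P(1), of x x] by (simp add: ip_diff_left)
  then have "norm ?p * norm ?p \<le> norm x * norm ?p"
    using Cauchy_Schwarz[of x ?p] by (simp add: norm_ip_self power2_eq_square)
  then show ?thesis by (cases "?p = 0") auto
qed

text \<open>As \<open>x - P x\<close> is orthogonal to \<open>M\<close>, pairing it with \<open>x - q\<close> gives \<open>\<parallel>x - P x\<parallel>\<^sup>2\<close>,
  and Cauchy-Schwarz concludes.\<close>

lemma orth_proj_dist_le:
  assumes "finite F" and M: "M = span F" and q: "q \<in> M"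
  shows "norm (x - orth_proj ip M x) \<le> norm (x - q)"
proof -
  note P = orth_proj_props[OF assms(1,2)]
  let ?p = "orth_proj ip M x"
  have pq: "?p - q \<in> M" using P(1) q M by (simp add: span_diff)
  have "ip (x - ?p) (x - q) = ip (x - ?p) (x - ?p) + ip (x - ?p) (?p - q)"
    by (simp add: ip_add_right[symmetric])
  also have "\<dots> = ip (x - ?p) (x - ?p)" using P(2)[OF pq] by simp
  finally have "norm (x - ?p) * norm (x - ?p) \<le> norm (x - ?p) * norm (x - q)"
    using Cauchy_Schwarz[of "x - ?p" "x - q"] by (simp add: norm_ip_self power2_eq_square)
  then show ?thesis by (cases "x - ?p = 0") auto
qed

end

section \<open>Square-summable sequences\<close>

definition l2 :: "(nat \<Rightarrow> 'b::real_normed_vector) \<Rightarrow> bool"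
  where "l2 a \<longleftrightarrow> summable (\<lambda>j. (norm (a j))\<^sup>2)"

definition l2norm :: "(nat \<Rightarrow> 'b::real_normed_vector) \<Rightarrow> real"
  where "l2norm a = sqrt (\<Sum>j. (norm (a j))\<^sup>2)"

text \<open>The partial sums decide both summability and the norm, so that estimates for finite sums
  pass to \<open>l\<^sup>2\<close>.\<close>

lemma l2_bounded:
  assumes "\<And>n. L2_set (\<lambda>j. norm (a j)) {..<n} \<le> C"
  shows "l2 a" and "l2norm a \<le> C"
proof -
  have C: "C \<ge> 0" using assms[of 0] by simp
  have *: "(\<Sum>j<n. (norm (a j))\<^sup>2) \<le> C\<^sup>2" for n
    using assms[of n] C unfolding L2_set_def
    by (metis (no_types, lifting) real_sqrt_le_iff real_sqrt_abs abs_of_nonneg)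
  show "l2 a" unfolding l2_def
    by (rule summableI_nonneg_bounded[of _ "C\<^sup>2"]) (use * in auto)
  then have "(\<Sum>j. (norm (a j))\<^sup>2) \<le> C\<^sup>2" unfolding l2_def
    by (rule suminf_le_const) (use * in auto)
  then show "l2norm a \<le> C" unfolding l2norm_def using C by (simp add: real_le_lsqrt)
qed

lemma l2norm_nonneg: "l2 a \<Longrightarrow> 0 \<le> l2norm a"
  unfolding l2norm_def l2_def by (simp add: suminf_nonneg)

lemma l2norm_power2: "l2 a \<Longrightarrow> (l2norm a)\<^sup>2 = (\<Sum>j. (norm (a j))\<^sup>2)"
  unfolding l2norm_def l2_def by (simp add: suminf_nonneg)

lemma L2_set_le_l2norm: "l2 a \<Longrightarrow> finite F \<Longrightarrow> L2_set (\<lambda>j. norm (a j)) F \<le> l2norm a"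
  unfolding L2_set_def l2norm_def l2_def
  by (intro real_sqrt_le_mono sum_le_suminf) auto

lemma l2_mono:
  assumes "l2 b" and "\<And>j. norm (a j) \<le> norm (b j)"
  shows "l2 a" and "l2norm a \<le> l2norm b"
proof -
  have "L2_set (\<lambda>j. norm (a j)) {..<n} \<le> l2norm b" for n
    using L2_set_mono[of "{..<n}" "\<lambda>j. norm (a j)" "\<lambda>j. norm (b j)"] assms(2)
      L2_set_le_l2norm[OF assms(1), of "{..<n}"] by force
  from l2_bounded[OF this] show "l2 a" and "l2norm a \<le> l2norm b" by auto
qed

lemma l2_add:
  assumes "l2 a" and "l2 b"
  shows "l2 (\<lambda>j. a j + b j)" and "l2norm (\<lambda>j. a j + b j) \<le> l2norm a + l2norm b"
proof -
  have "L2_set (\<lambda>j. norm (a j + b j)) {..<n} \<le> l2norm a + l2norm b" for n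
  proof -
    have "L2_set (\<lambda>j. norm (a j + b j)) {..<n} \<le> L2_set (\<lambda>j. norm (a j) + norm (b j)) {..<n}"
      by (rule L2_set_mono) (auto simp: norm_triangle_ineq)
    also have "\<dots> \<le> L2_set (\<lambda>j. norm (a j)) {..<n} + L2_set (\<lambda>j. norm (b j)) {..<n}"
      by (rule L2_set_triangle_ineq)
    finally show ?thesis
      using L2_set_le_l2norm[OF assms(1), of "{..<n}"] L2_set_le_l2norm[OF assms(2), of "{..<n}"]
      by simp
  qed
  from l2_bounded[OF this] show "l2 (\<lambda>j. a j + b j)"
    and "l2norm (\<lambda>j. a j + b j) \<le> l2norm a + l2norm b" by auto
qed

lemma l2_diff:
  assumes "l2 a" and "l2 b"
  shows "l2 (\<lambda>j. a j - b j)" and "l2norm (\<lambda>j. a j - b j) \<le> l2norm a + l2norm b"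
proof -
  have "l2 (\<lambda>j. - b j)" "l2norm (\<lambda>j. - b j) = l2norm b"
    using assms(2) by (auto simp: l2_def l2norm_def)
  with l2_add[OF assms(1), of "\<lambda>j. - b j"]
  show "l2 (\<lambda>j. a j - b j)" and "l2norm (\<lambda>j. a j - b j) \<le> l2norm a + l2norm b" by auto
qed

definition tail :: "(nat \<Rightarrow> 'b::real_normed_vector) \<Rightarrow> nat \<Rightarrow> real"
  where "tail a N = l2norm (\<lambda>j. if N \<le> j then a j else 0)"

lemma l2_tail: "l2 a \<Longrightarrow> l2 (\<lambda>j. if N \<le> j then a j else 0)"
  by (erule l2_mono) auto

lemma tail_nonneg: "l2 a \<Longrightarrow> 0 \<le> tail a N"
  unfolding tail_def by (intro l2norm_nonneg l2_tail)

lemma tail_mono: "l2 a \<Longrightarrow> M \<le> N \<Longrightarrow> tail a N \<le> tail a M"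
  unfolding tail_def by (intro l2_mono(2) l2_tail) auto

lemma tail_le_l2norm: "l2 a \<Longrightarrow> tail a N \<le> l2norm a"
  unfolding tail_def by (rule l2_mono(2)) auto

section \<open>Frames and the frame operator\<close>

locale hilbert_frame = hilbert_space smul ip
  for smul :: "'k::hilbert_scalar \<Rightarrow> 'a::{banach, second_countable_topology} \<Rightarrow> 'a"
    and ip :: "'a \<Rightarrow> 'a \<Rightarrow> 'k" +
  fixes \<phi> :: "nat \<Rightarrow> 'a" and A B :: real
  assumes A_pos: "A > 0" and B_pos: "B > 0"
    and frame_summable: "summable (\<lambda>j. (norm (ip h (\<phi> j)))\<^sup>2)"
    and frame_lower: "A * (norm h)\<^sup>2 \<le> (\<Sum>j. (norm (ip h (\<phi> j)))\<^sup>2)"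
    and frame_upper: "(\<Sum>j. (norm (ip h (\<phi> j)))\<^sup>2) \<le> B * (norm h)\<^sup>2"
begin

definition coef :: "'a \<Rightarrow> nat \<Rightarrow> 'k" where "coef h j = ip h (\<phi> j)"

definition syn :: "(nat \<Rightarrow> 'k) \<Rightarrow> 'a" where "syn a = (\<Sum>j. smul (a j) (\<phi> j))"

definition S :: "'a \<Rightarrow> 'a" where "S h = syn (coef h)"

lemma l2_coef: "l2 (coef h)"
  unfolding l2_def coef_def by (rule frame_summable)

lemma coef_lower: "A * (norm h)\<^sup>2 \<le> (l2norm (coef h))\<^sup>2"
  unfolding l2norm_power2[OF l2_coef] unfolding coef_def by (rule frame_lower)

lemma coef_upper: "l2norm (coef h) \<le> sqrt B * norm h"
proof -
  have "(l2norm (coef h))\<^sup>2 \<le> (sqrt B * norm h)\<^sup>2"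
    unfolding l2norm_power2[OF l2_coef] power_mult_distrib
    using frame_upper[of h] B_pos unfolding coef_def by simp
  then show ?thesis using B_pos by (rule_tac power2_le_imp_le) auto
qed

lemma coef_diff: "coef (x - y) = (\<lambda>j. coef x j - coef y j)"
  by (simp add: coef_def ip_diff_left fun_eq_iff)

text \<open>Duality: pairing the vector with itself turns the sum into a pairing of \<open>a\<close> with the analysis
  coefficients of that vector, to which the upper frame bound applies.\<close>

lemma norm_syn_finite:
  assumes "finite F"
  shows "norm (\<Sum>j\<in>F. smul (a j) (\<phi> j)) \<le> sqrt B * L2_set (\<lambda>j. norm (a j)) F"
proof -
  define v where "v = (\<Sum>j\<in>F. smul (a j) (\<phi> j))"
  have "norm v * norm v = norm (\<Sum>j\<in>F. a j * ip (\<phi> j) v)"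
    unfolding power2_eq_square[symmetric] norm_ip_self[symmetric]
    by (subst (1) v_def) (simp add: ip_sum_left ip_smul_left)
  also have "\<dots> \<le> (\<Sum>j\<in>F. \<bar>norm (a j)\<bar> * \<bar>norm (coef v j)\<bar>)"
    by (rule order_trans[OF norm_sum])
       (simp add: norm_mult coef_def norm_ip_commute[of v])
  also have "\<dots> \<le> L2_set (\<lambda>j. norm (a j)) F * L2_set (\<lambda>j. norm (coef v j)) F"
    by (rule L2_set_mult_ineq)
  also have "\<dots> \<le> L2_set (\<lambda>j. norm (a j)) F * (sqrt B * norm v)"
    using L2_set_le_l2norm[OF l2_coef assms, of v] coef_upper[of v]
    by (intro mult_left_mono) auto
  finally have "norm v * norm v \<le> (sqrt B * L2_set (\<lambda>j. norm (a j)) F) * norm v"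
    by (simp add: algebra_simps)
  then show ?thesis
    unfolding v_def[symmetric] using B_pos by (cases "v = 0") auto
qed

lemma summable_syn:
  assumes "l2 a"
  shows "summable (\<lambda>j. smul (a j) (\<phi> j))"
  unfolding summable_Cauchy
proof (intro allI impI)
  fix e :: real assume e: "e > 0"
  define d where "d = (e / sqrt B)\<^sup>2"
  have d: "d > 0" using e B_pos by (simp add: d_def)
  obtain N where N: "\<And>m n. m \<ge> N \<Longrightarrow> norm (\<Sum>j\<in>{m..<n}. (norm (a j))\<^sup>2) < d"
    using assms d unfolding l2_def summable_Cauchy by blast
  have "norm (\<Sum>j\<in>{m..<n}. smul (a j) (\<phi> j)) < e" if "m \<ge> N" for m n
  proof -
    have "L2_set (\<lambda>j. norm (a j)) {m..<n} < sqrt d"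
      using N[OF that, of n] unfolding L2_set_def
      by (simp add: real_sqrt_less_iff sum_nonneg)
    then have "sqrt B * L2_set (\<lambda>j. norm (a j)) {m..<n} < sqrt B * (e / sqrt B)"
      using e B_pos unfolding d_def by (intro mult_strict_left_mono) auto
    then show ?thesis
      using norm_syn_finite[of "{m..<n}" a] B_pos by simp
  qed
  then show "\<exists>N. \<forall>m\<ge>N. \<forall>n. norm (\<Sum>j\<in>{m..<n}. smul (a j) (\<phi> j)) < e" by blast
qed

lemma syn_sums: "l2 a \<Longrightarrow> (\<lambda>j. smul (a j) (\<phi> j)) sums syn a"
  unfolding syn_def by (intro summable_sums summable_syn)

lemma norm_syn_le:
  assumes "l2 a"
  shows "norm (syn a) \<le> sqrt B * l2norm a"
proof (rule LIMSEQ_le_const2)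
  show "(\<lambda>n. norm (\<Sum>j<n. smul (a j) (\<phi> j))) \<longlonglongrightarrow> norm (syn a)"
    using syn_sums[OF assms] unfolding sums_def by (rule tendsto_norm)
  have "norm (\<Sum>j<n. smul (a j) (\<phi> j)) \<le> sqrt B * l2norm a" for n
    using norm_syn_finite[of "{..<n}" a] L2_set_le_l2norm[OF assms, of "{..<n}"] B_pos
    by (meson finite_lessThan mult_left_mono order_trans real_sqrt_ge_zero less_imp_le)
  then show "\<exists>N. \<forall>n\<ge>N. norm (\<Sum>j<n. smul (a j) (\<phi> j)) \<le> sqrt B * l2norm a" by blast
qed

lemma syn_diff: "l2 a \<Longrightarrow> l2 b \<Longrightarrow> syn (\<lambda>j. a j - b j) = syn a - syn b"
  using sums_diff[OF syn_sums syn_sums, of a b] syn_sums[OF l2_diff(1), of a b]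
  by (simp add: scale_left_diff_distrib sums_unique2)

lemma ip_syn: "l2 a \<Longrightarrow> (\<lambda>j. a j * ip (\<phi> j) h) sums ip (syn a) h"
  using bounded_linear.sums[OF bounded_linear_ip syn_sums, of a h] by (simp add: ip_smul_left)

lemma S_diff: "S (x - y) = S x - S y"
  unfolding S_def coef_diff by (intro syn_diff l2_coef)

lemma ip_S_self: "ip (S h) h = of_real ((l2norm (coef h))\<^sup>2)"
proof -
  have "coef h j * ip (\<phi> j) h = of_real ((norm (coef h j))\<^sup>2)" for j
    unfolding mult_cnjg_of_real[symmetric] coef_def by (simp add: ip_commute[of "\<phi> j" h])
  then have "(\<lambda>j. of_real ((norm (coef h j))\<^sup>2)) sums ip (S h) h"
    using ip_syn[OF l2_coef, of h h] by (simp only: S_def)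
  moreover have "(\<lambda>j. of_real ((norm (coef h j))\<^sup>2) :: 'k) sums of_real ((l2norm (coef h))\<^sup>2)"
    unfolding l2norm_power2[OF l2_coef]
    using l2_coef[of h] unfolding l2_def by (intro sums_of_real summable_sums)
  ultimately show ?thesis by (rule sums_unique2)
qed

lemma S_lower: "A * norm h \<le> norm (S h)"
proof -
  have "A * norm h * norm h \<le> norm (ip (S h) h)"
    using coef_lower[of h] unfolding ip_S_self norm_of_real by (simp add: power2_eq_square)
  also have "\<dots> \<le> norm (S h) * norm h" by (rule Cauchy_Schwarz)
  finally show ?thesis by (cases "h = 0") auto
qed

text \<open>Since \<open>\<parallel>S u\<parallel>\<^sup>2 \<le> B \<langle>S u, u\<rangle>\<close> and \<open>\<langle>S u, u\<rangle> \<ge> A \<parallel>u\<parallel>\<^sup>2\<close>,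
  expanding the square shows that \<open>I - S / B\<close> is a contraction.\<close>

lemma S_contraction: "(norm (u - (1 / B) *\<^sub>R S u))\<^sup>2 \<le> (1 - A / B) * (norm u)\<^sup>2"
proof -
  define q where "q = (l2norm (coef u))\<^sup>2"
  have qS: "ip (S u) u = of_real q" unfolding q_def by (rule ip_S_self)
  then have qS': "ip u (S u) = of_real q" by (simp add: ip_commute[of u "S u"])
  have "ip (u - (1 / B) *\<^sub>R S u) (u - (1 / B) *\<^sub>R S u)
      = of_real ((norm u)\<^sup>2) - of_real (q / B) - (of_real (q / B) - of_real ((norm (S u))\<^sup>2 / B\<^sup>2))"
    unfolding ip_diff_left ip_diff_right ip_scaleR_left ip_scaleR_right qS qS' ip_self[of u]
      ip_self[of "S u"] scaleR_conv_of_real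
    by (simp add: power2_eq_square diff_divide_distrib)
  then have "of_real ((norm (u - (1 / B) *\<^sub>R S u))\<^sup>2)
      = (of_real ((norm u)\<^sup>2 - q / B - (q / B - (norm (S u))\<^sup>2 / B\<^sup>2)) :: 'k)"
    by (simp only: ip_self of_real_diff)
  then have eq: "(norm (u - (1 / B) *\<^sub>R S u))\<^sup>2 = (norm u)\<^sup>2 - q / B - (q / B - (norm (S u))\<^sup>2 / B\<^sup>2)"
    by (simp only: of_real_eq_iff)
  have "norm (S u) \<le> sqrt B * l2norm (coef u)" unfolding S_def by (intro norm_syn_le l2_coef)
  then have "(norm (S u))\<^sup>2 \<le> (sqrt B * l2norm (coef u))\<^sup>2" by (rule power_mono) simp
  also have "\<dots> = B * q" using B_pos by (simp add: power_mult_distrib q_def)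
  finally have "(norm (S u))\<^sup>2 / B\<^sup>2 \<le> B * q / B\<^sup>2" by (rule divide_right_mono) simp
  also have "\<dots> = q / B" using B_pos by (simp add: power2_eq_square)
  finally have "(norm (u - (1 / B) *\<^sub>R S u))\<^sup>2 \<le> (norm u)\<^sup>2 - q / B" unfolding eq by simp
  moreover have "A * (norm u)\<^sup>2 / B \<le> q / B"
    using coef_lower[of u] B_pos unfolding q_def by (intro divide_right_mono) auto
  ultimately show ?thesis by (simp add: algebra_simps)
qed

lemma S_surj: "surj S"
proof (rule surjI[where f = "\<lambda>y. SOME x. S x = y"])
  fix y
  \<comment> \<open>The maximum matters only when the space is trivial, where \<open>A > B\<close> is possible.\<close>
  define c where "c = sqrt (max 0 (1 - A / B))"
  have c: "0 \<le> c" "c < 1" using A_pos B_pos by (auto simp: c_def max_def)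
  \<comment> \<open>Its fixed points are the solutions of \<open>S x = y\<close>.\<close>
  define T where "T x = x - (1 / B) *\<^sub>R (S x - y)" for x
  have "dist (T x) (T x') \<le> c * dist x x'" for x x'
  proof -
    have "T x - T x' = (x - x') - (1 / B) *\<^sub>R S (x - x')"
      by (simp add: T_def S_diff algebra_simps)
    then have "(norm (T x - T x'))\<^sup>2 \<le> (1 - A / B) * (norm (x - x'))\<^sup>2"
      using S_contraction[of "x - x'"] by simp
    also have "\<dots> \<le> max 0 (1 - A / B) * (norm (x - x'))\<^sup>2" by (intro mult_right_mono) auto
    also have "\<dots> = (c * norm (x - x'))\<^sup>2" by (simp add: c_def power_mult_distrib)
    finally show ?thesis unfolding dist_norm using c by (rule_tac power2_le_imp_le) auto
  qed
  then have "\<exists>!x. T x = x" by (intro banach_fix_type[OF c]) auto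
  then obtain x where "T x = x" by blast
  then have "S x = y" using B_pos by (simp add: T_def)
  then show "S (SOME x. S x = y) = y" by (rule someI)
qed

section \<open>Commuting a cutoff with the Gram operator\<close>

definition cut :: "(nat \<Rightarrow> real) \<Rightarrow> 'a \<Rightarrow> nat \<Rightarrow> 'k"
  where "cut \<omega> h = (\<lambda>j. \<omega> j *\<^sub>R coef h j)"

text \<open>Let \<open>T\<close> be the analysis operator \<^const>\<open>coef\<close> and \<open>T\<^sup>*\<close> its adjoint \<^const>\<open>syn\<close>, so that \<open>S = T\<^sup>* T\<close>, and
  let \<open>G = T T\<^sup>*\<close> be the Gram operator. As \<open>T S = G T\<close>, the sequence below is the commutator
  \<open>[\<omega>, G]\<close>, where \<open>\<omega>\<close> acts by multiplication, applied to \<open>T h\<close>.\<close>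

definition comm :: "(nat \<Rightarrow> real) \<Rightarrow> 'a \<Rightarrow> nat \<Rightarrow> 'k"
  where "comm \<omega> h = (\<lambda>j. cut \<omega> (S h) j - coef (syn (cut \<omega> h)) j)"

lemma l2_cut: "(\<And>j. 0 \<le> \<omega> j \<and> \<omega> j \<le> 1) \<Longrightarrow> l2 (cut \<omega> h)"
  by (rule l2_mono(1)[OF l2_coef[of h]]) (simp add: cut_def mult_left_le_one_le)

text \<open>The point is to bound \<open>\<omega> T (S h)\<close> by \<open>\<omega> T (S (S h))\<close> up to commutators, although \<open>G\<close> need not
  be invertible and \<open>\<omega>\<close> does not preserve the range of \<open>T\<close>. Invertibility is used for \<open>S\<close> only.
  Commuting \<open>\<omega>\<close> past \<open>G\<close> gives \<open>S t = T\<^sup>* (\<omega> T S S h - [\<omega>, G] T S h)\<close> for \<open>t = T\<^sup>* \<omega> T S h\<close>,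
  which bounds \<open>t\<close>. Commuting once more gives \<open>\<omega> T S h = T k + [\<omega>, G] T h\<close> for \<open>k = T\<^sup>* \<omega> T h\<close>, and
  applying \<open>T\<^sup>*\<close> to this gives \<open>S k = t - T\<^sup>* [\<omega>, G] T h\<close>, which bounds \<open>k\<close>.\<close>

lemma cutoff_estimate:
  assumes \<omega>: "\<And>j. 0 \<le> \<omega> j \<and> \<omega> j \<le> 1"
  shows "l2norm (cut \<omega> (S h)) \<le> (B / A\<^sup>2 + B / A + 1) *
    (l2norm (cut \<omega> (S (S h))) + l2norm (comm \<omega> (S h)) + l2norm (comm \<omega> h))"
proof -
  note [simp] = l2_cut[OF \<omega>] l2_coef
  have l2_comm [simp]: "l2 (comm \<omega> h)" for h unfolding comm_def by (intro l2_diff) simp_all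
  let ?x = "l2norm (cut \<omega> (S (S h)))" and ?r = "l2norm (comm \<omega> (S h))" and ?r' = "l2norm (comm \<omega> h)"
  define k where "k = syn (cut \<omega> h)"
  define t where "t = syn (cut \<omega> (S h))"
  have nonneg: "0 \<le> ?x" "0 \<le> ?r" "0 \<le> ?r'" by (auto intro!: l2norm_nonneg)
  have "S t = syn (\<lambda>j. cut \<omega> (S (S h)) j - comm \<omega> (S h) j)"
    by (simp add: S_def t_def comm_def)
  then have "norm (S t) \<le> sqrt B * l2norm (\<lambda>j. cut \<omega> (S (S h)) j - comm \<omega> (S h) j)"
    by (simp add: norm_syn_le l2_diff)
  also have "\<dots> \<le> sqrt B * (?x + ?r)" using B_pos by (intro mult_left_mono l2_diff) auto
  finally have "A * norm t \<le> sqrt B * (?x + ?r)" using S_lower[of t] by linarith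
  then have t: "norm t \<le> sqrt B * (?x + ?r) / A" using A_pos by (simp add: field_simps)
  have split: "cut \<omega> (S h) = (\<lambda>j. coef k j + comm \<omega> h j)" by (simp add: comm_def k_def)
  have "S k = syn (\<lambda>j. cut \<omega> (S h) j - comm \<omega> h j)"
    by (simp add: S_def k_def comm_def)
  then have "S k = t - syn (comm \<omega> h)" unfolding t_def by (simp add: syn_diff)
  then have "norm (S k) \<le> norm t + norm (syn (comm \<omega> h))" by (simp add: norm_triangle_ineq4)
  also have "\<dots> \<le> norm t + sqrt B * ?r'" by (simp add: norm_syn_le)
  finally have "A * norm k \<le> norm t + sqrt B * ?r'" using S_lower[of k] by linarith
  then have "A * norm k \<le> sqrt B * (?x + ?r) / A + sqrt B * ?r'" using t by linarith
  then have "norm k \<le> (sqrt B * (?x + ?r) / A + sqrt B * ?r') / A"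
    by (simp only: pos_le_divide_eq[OF A_pos] mult.commute[of _ A])
  then have "sqrt B * norm k \<le> sqrt B * ((sqrt B * (?x + ?r) / A + sqrt B * ?r') / A)"
    using B_pos by (intro mult_left_mono) auto
  also have "\<dots> = (sqrt B * sqrt B) * ((?x + ?r) / A\<^sup>2 + ?r' / A)"
    using A_pos by (simp add: field_simps power2_eq_square del: real_sqrt_mult_self)
  also have "\<dots> = B / A\<^sup>2 * (?x + ?r) + B / A * ?r'"
    using B_pos by (simp add: distrib_left add_divide_distrib)
  finally have k: "sqrt B * norm k \<le> B / A\<^sup>2 * (?x + ?r) + B / A * ?r'" .
  have "l2norm (cut \<omega> (S h)) \<le> l2norm (coef k) + ?r'"
    unfolding split by (intro l2_add) auto
  also have "\<dots> \<le> B / A\<^sup>2 * (?x + ?r) + B / A * ?r' + ?r'"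
    using coef_upper[of k] k by linarith
  also have "\<dots> \<le> (B / A\<^sup>2 + B / A + 1) * (?x + ?r + ?r')"
  proof -
    have "0 \<le> B / A\<^sup>2 * ?r'" "0 \<le> (B / A + 1) * (?x + ?r)" using nonneg A_pos B_pos by auto
    then show ?thesis by (simp add: algebra_simps)
  qed
  finally show ?thesis .
qed

lemma comm_sums:
  assumes \<omega>: "\<And>j. 0 \<le> \<omega> j \<and> \<omega> j \<le> 1"
  shows "(\<lambda>l. (\<omega> j - \<omega> l) *\<^sub>R (coef h l * ip (\<phi> l) (\<phi> j))) sums comm \<omega> h j"
proof -
  have "(\<lambda>l. \<omega> j *\<^sub>R (coef h l * ip (\<phi> l) (\<phi> j)) - cut \<omega> h l * ip (\<phi> l) (\<phi> j))
      sums (\<omega> j *\<^sub>R ip (S h) (\<phi> j) - ip (syn (cut \<omega> h)) (\<phi> j))"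
    unfolding S_def by (intro sums_diff sums_scaleR_right ip_syn l2_coef l2_cut \<omega>)
  then show ?thesis
    by (simp add: comm_def cut_def coef_def[of "S h"] coef_def[of "syn _"] scaleR_left_diff_distrib
        fun_eq_iff)
qed

end

section \<open>Sums of inverse powers and Schur's test\<close>

text \<open>By the mean value theorem each summand is at most a difference of consecutive values of
  \<open>x powr (- p) / p\<close>, and these differences telescope.\<close>

lemma sum_powr_shift_le:
  fixes p c :: real
  assumes p: "p > 0" and a: "real a > c"
  shows "(\<Sum>j=a..<b. (1 + (real j - c)) powr (- p - 1)) \<le> (real a - c) powr (- p) / p"
proof -
  have step: "p * (1 + x) powr (- p - 1) \<le> x powr (- p) - (1 + x) powr (- p)" if "x > 0" for x :: real
  proof -
    have "((\<lambda>u. u powr (- p)) has_real_derivative - p * u powr (- p - 1)) (at u)" if "u > 0" for u :: real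
      using that by (auto intro!: derivative_eq_intros)
    then obtain z where z: "z > x" "z < 1 + x"
      "(1 + x) powr (- p) - x powr (- p) = (1 + x - x) * (- p * z powr (- p - 1))"
      using MVT2[of x "1 + x" "\<lambda>u. u powr (- p)" "\<lambda>u. - p * u powr (- p - 1)"] \<open>x > 0\<close>
      by force
    have "(1 + x) powr (- p - 1) \<le> z powr (- p - 1)"
      using z \<open>x > 0\<close> p by (intro powr_mono2') auto
    then have "p * (1 + x) powr (- p - 1) \<le> p * z powr (- p - 1)" using p by (intro mult_left_mono) auto
    then show ?thesis using z(3) by simp
  qed
  have "p * (\<Sum>j=a..<b. (1 + (real j - c)) powr (- p - 1)) \<le> (real a - c) powr (- p)"
  proof (cases "a \<le> b")
    case True
    then have "p * (\<Sum>j=a..<b. (1 + (real j - c)) powr (- p - 1))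
        \<le> (real a - c) powr (- p) - (real b - c) powr (- p)"
    proof (induction b rule: dec_induct)
      case (step n)
      have "p * (1 + (real n - c)) powr (- p - 1)
          \<le> (real n - c) powr (- p) - (1 + (real n - c)) powr (- p)"
        using a step.hyps by (intro \<open>\<And>x. x > 0 \<Longrightarrow> _ x\<close>) auto
      with step show ?case by (simp add: algebra_simps)
    qed simp
    then show ?thesis by (smt (verit) powr_ge_zero)
  qed simp
  then show ?thesis using p by (simp add: field_simps)
qed

lemma sum_powr_dist_le:
  fixes t :: real
  assumes "t > 1"
  shows "(\<Sum>l<L. (1 + \<bar>real j - real l\<bar>) powr (- t)) \<le> 1 + 2 / (t - 1)"
proof -
  let ?g = "\<lambda>l. (1 + \<bar>real j - real l\<bar>) powr (- t)"
  have "sum ?g {..<L} \<le> sum ?g ({..<j} \<union> {j} \<union> {Suc j..<L})"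
    by (rule sum_mono2) auto
  also have "\<dots> = sum ?g ({..<j} \<union> {j}) + sum ?g {Suc j..<L}"
    by (rule sum.union_disjoint) auto
  also have "sum ?g ({..<j} \<union> {j}) = sum ?g {..<j} + ?g j"
    by (simp add: add.commute)
  also have "sum ?g {Suc j..<L} = (\<Sum>l=Suc j..<L. (1 + (real l - real j)) powr (- (t - 1) - 1))"
    by (rule sum.cong) auto
  also have "\<dots> \<le> 1 / (t - 1)"
    using sum_powr_shift_le[of "t - 1" "real j" "Suc j" L] assms by simp
  also have "sum ?g {..<j} = (\<Sum>i<j. ?g (j - Suc i))"
    by (rule sum.nat_diff_reindex[symmetric])
  also have "\<dots> = (\<Sum>i=0..<j. (1 + (real i - (- 1))) powr (- (t - 1) - 1))"
    by (rule sum.cong) (auto simp: of_nat_diff)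
  also have "\<dots> \<le> 1 / (t - 1)"
    using sum_powr_shift_le[of "t - 1" "- 1" 0 j] assms by simp
  finally show ?thesis by simp
qed

text \<open>Cauchy-Schwarz with the weight \<open>\<kappa> j l\<close> split evenly between the two factors.\<close>

lemma Schur_test:
  fixes \<kappa> :: "'i \<Rightarrow> 'j \<Rightarrow> real"
  assumes pos: "\<And>j l. \<kappa> j l \<ge> 0" and M: "M \<ge> 0"
    and row: "\<And>j. j \<in> J \<Longrightarrow> (\<Sum>l\<in>L. \<kappa> j l) \<le> M"
    and col: "\<And>l. l \<in> L \<Longrightarrow> (\<Sum>j\<in>J. \<kappa> j l) \<le> M"
  shows "L2_set (\<lambda>j. \<Sum>l\<in>L. \<kappa> j l * v l) J \<le> M * L2_set v L"
proof -
  have "(\<Sum>l\<in>L. \<kappa> j l * v l)\<^sup>2 \<le> M * (\<Sum>l\<in>L. \<kappa> j l * (v l)\<^sup>2)" if "j \<in> J" for j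
  proof -
    have "(\<Sum>l\<in>L. \<kappa> j l * v l)\<^sup>2 = (\<Sum>l\<in>L. sqrt (\<kappa> j l) * (sqrt (\<kappa> j l) * v l))\<^sup>2"
      by (simp add: pos mult.assoc[symmetric])
    also have "\<dots> \<le> (\<Sum>l\<in>L. (sqrt (\<kappa> j l))\<^sup>2) * (\<Sum>l\<in>L. (sqrt (\<kappa> j l) * v l)\<^sup>2)"
      by (rule Cauchy_Schwarz_ineq_sum)
    also have "\<dots> = (\<Sum>l\<in>L. \<kappa> j l) * (\<Sum>l\<in>L. \<kappa> j l * (v l)\<^sup>2)"
      by (simp add: pos power_mult_distrib)
    also have "\<dots> \<le> M * (\<Sum>l\<in>L. \<kappa> j l * (v l)\<^sup>2)"
      by (intro mult_right_mono row that sum_nonneg) (auto simp: pos)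
    finally show ?thesis .
  qed
  then have "(\<Sum>j\<in>J. (\<Sum>l\<in>L. \<kappa> j l * v l)\<^sup>2) \<le> (\<Sum>j\<in>J. M * (\<Sum>l\<in>L. \<kappa> j l * (v l)\<^sup>2))"
    by (rule sum_mono)
  also have "\<dots> = M * (\<Sum>l\<in>L. \<Sum>j\<in>J. \<kappa> j l * (v l)\<^sup>2)"
    unfolding sum_distrib_left[symmetric] by (subst sum.swap) simp
  also have "\<dots> = M * (\<Sum>l\<in>L. (\<Sum>j\<in>J. \<kappa> j l) * (v l)\<^sup>2)"
    by (simp add: sum_distrib_right)
  also have "\<dots> \<le> M * (\<Sum>l\<in>L. M * (v l)\<^sup>2)"
    by (intro mult_left_mono sum_mono mult_right_mono col M) auto
  also have "\<dots> = M\<^sup>2 * (\<Sum>l\<in>L. (v l)\<^sup>2)"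
    by (simp add: sum_distrib_left power2_eq_square mult.assoc)
  finally have "sqrt (\<Sum>j\<in>J. (\<Sum>l\<in>L. \<kappa> j l * v l)\<^sup>2) \<le> sqrt (M\<^sup>2 * (\<Sum>l\<in>L. (v l)\<^sup>2))"
    by (rule real_sqrt_le_mono)
  then show ?thesis unfolding L2_set_def real_sqrt_mult using M by simp
qed

section \<open>Polynomial decay of tails\<close>

lemma powr_square: "(x powr a)\<^sup>2 = x powr (2 * a)" for x a :: real
  by (simp add: power2_eq_square powr_add[symmetric])

definition tail_decay :: "real \<Rightarrow> (nat \<Rightarrow> 'b::real_normed_vector) \<Rightarrow> bool"
  where "tail_decay a v \<longleftrightarrow> l2 v \<and> (\<exists>C\<ge>0. \<forall>N\<ge>1. tail v N \<le> C * real N powr (- a))"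

lemma tail_decay_zero: "l2 v \<Longrightarrow> tail_decay 0 v"
  unfolding tail_decay_def
  by (intro conjI exI[of _ "l2norm v"]) (auto simp: l2norm_nonneg tail_le_l2norm)

lemma tail_decay_mono:
  assumes "tail_decay a v" and "b \<le> a"
  shows "tail_decay b v"
proof -
  obtain C where C: "C \<ge> 0" "\<And>N. N \<ge> 1 \<Longrightarrow> tail v N \<le> C * real N powr (- a)" and v: "l2 v"
    using assms(1) unfolding tail_decay_def by blast
  have "tail v N \<le> C * real N powr (- b)" if "N \<ge> 1" for N
  proof -
    have "C * real N powr (- a) \<le> C * real N powr (- b)"
      using that assms(2) C(1) by (intro mult_left_mono powr_mono) auto
    with C(2)[OF that] show ?thesis by linarith
  qed
  with C(1) v show ?thesis unfolding tail_decay_def by blast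
qed

text \<open>The cutoff used below ramps up from \<open>2 N\<close> to \<open>4 N\<close> and so yields bounds at multiples of four only.
  As \<open>4 (M div 4) \<le> M \<le> 8 (M div 4)\<close> for \<open>M \<ge> 4\<close>, filling the gaps costs a factor \<open>8 powr b\<close>.\<close>

lemma tail_decay_of_multiples:
  assumes v: "l2 v" and b: "b \<ge> 0" and C: "C \<ge> 0"
    and le: "\<And>N. N \<ge> 1 \<Longrightarrow> tail v (4 * N) \<le> C * real N powr (- b)"
  shows "tail_decay b v"
proof -
  define D where "D = (C + l2norm v) * 8 powr b"
  have "tail v M \<le> D * real M powr (- b)" if M: "M \<ge> 1" for M
  proof -
    have scale: "(real M / 8) powr (- b) = 8 powr b * real M powr (- b)"
      using M by (simp add: powr_divide powr_minus field_simps)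
    show ?thesis
    proof (cases "M < 4")
      case True
      have "l2norm v * 1 \<le> l2norm v * (real M / 8) powr (- b)"
        using True M b v powr_mono2'[of "- b" "real M / 8" 1]
        by (intro mult_left_mono l2norm_nonneg) auto
      also have "\<dots> \<le> (C + l2norm v) * (real M / 8) powr (- b)"
        using C by (intro mult_right_mono) auto
      finally show ?thesis
        using tail_le_l2norm[OF v, of M] unfolding D_def scale by (simp add: mult.assoc)
    next
      case False
      define N where "N = M div 4"
      have "M \<le> 8 * N" using False unfolding N_def by presburger
      then have "real M \<le> real (8 * N)" by (rule of_nat_mono)
      then have N: "N \<ge> 1" "4 * N \<le> M" "real M / 8 \<le> real N" using False unfolding N_def by auto
      have "tail v M \<le> tail v (4 * N)" using N v by (intro tail_mono)
      also have "\<dots> \<le> C * real N powr (- b)" by (rule le[OF N(1)])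
      also have "\<dots> \<le> C * (real M / 8) powr (- b)"
        using N b C M powr_mono2'[of "- b" "real M / 8" "real N"] by (intro mult_left_mono) auto
      also have "\<dots> \<le> (C + l2norm v) * (real M / 8) powr (- b)"
        using v by (intro mult_right_mono) (auto simp: l2norm_nonneg)
      finally show ?thesis unfolding D_def scale by (simp add: mult.assoc)
    qed
  qed
  moreover have "D \<ge> 0" using C v by (simp add: D_def l2norm_nonneg)
  ultimately show ?thesis using v unfolding tail_decay_def by blast
qed

lemma tail_decay_of_pointwise:
  assumes v: "l2 v" and s: "s > 1 / 2" and c: "c \<ge> 0"
    and le: "\<And>j. norm (v j) \<le> c * (1 + real j) powr (- s)"
  shows "tail_decay (s - 1 / 2) v"
proof -
  define C where "C = c / sqrt (2 * s - 1)"
  have "tail v N \<le> C * real N powr (- (s - 1 / 2))" if N: "N \<ge> 1" for N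
    unfolding tail_def
  proof (rule l2_bounded(2))
    fix n
    have sq: "(c * (1 + real j) powr (- s))\<^sup>2 = c\<^sup>2 * (1 + (real j - 0)) powr (- (2 * s - 1) - 1)" for j
      by (simp add: power_mult_distrib powr_square)
    have "(\<Sum>j<n. (norm (if N \<le> j then v j else 0))\<^sup>2) = (\<Sum>j=N..<n. (norm (v j))\<^sup>2)"
      by (rule sum.mono_neutral_cong_right) auto
    also have "\<dots> \<le> (\<Sum>j=N..<n. (c * (1 + real j) powr (- s))\<^sup>2)"
      by (intro sum_mono power_mono le) auto
    also have "\<dots> \<le> c\<^sup>2 * ((real N - 0) powr (- (2 * s - 1)) / (2 * s - 1))"
      unfolding sq sum_distrib_left[symmetric]
      using N s by (intro mult_left_mono sum_powr_shift_le) auto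
    also have "\<dots> = (C * real N powr (- (s - 1 / 2)))\<^sup>2"
      using s N by (simp add: C_def power_mult_distrib power_divide powr_square algebra_simps)
    finally have "sqrt (\<Sum>j<n. (norm (if N \<le> j then v j else 0))\<^sup>2) \<le> \<bar>C * real N powr (- (s - 1 / 2))\<bar>"
      by (metis real_sqrt_le_mono real_sqrt_abs)
    moreover have "C * real N powr (- (s - 1 / 2)) \<ge> 0" using c s by (simp add: C_def)
    ultimately show "L2_set (\<lambda>j. norm (if N \<le> j then v j else 0)) {..<n} \<le> C * real N powr (- (s - 1 / 2))"
      unfolding L2_set_def by linarith
  qed
  moreover have "C \<ge> 0" using c s by (simp add: C_def)
  ultimately show ?thesis using v unfolding tail_decay_def by blast
qed

text \<open>On the dyadic block from \<open>2 ^ i\<close> to \<open>2 ^ (i + 1)\<close>, Cauchy-Schwarz bounds the sum by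
  \<open>2 powr (i / 2)\<close> times the tail at \<open>2 ^ i\<close>, that is, by a multiple of \<open>q ^ i\<close> with
  \<open>q = 2 powr (1 / 2 - a)\<close>. The blocks form a geometric series, growing or convergent according to
  the sign of \<open>1 / 2 - a\<close>; for \<open>a = 1 / 2\<close> a logarithm would appear.\<close>

lemma partial_sums_of_tail_decay:
  assumes dec: "tail_decay a v" and a: "a \<noteq> 1 / 2"
  shows "\<exists>C\<ge>0. \<forall>N\<ge>1. (\<Sum>l<N. norm (v l)) \<le> C * real N powr (max 0 (1 / 2 - a))"
proof -
  obtain C where C: "C \<ge> 0" "\<And>N. N \<ge> 1 \<Longrightarrow> tail v N \<le> C * real N powr (- a)" and v: "l2 v"
    using dec unfolding tail_decay_def by blast
  define e where "e = max 0 (1 / 2 - a)"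
  define q where "q = 2 powr (1 / 2 - a)"
  have q: "q > 0" "q \<noteq> 1" using a by (auto simp: q_def)
  have block: "(\<Sum>l=2^i..<2^Suc i. norm (v l)) \<le> C * q ^ i" for i
  proof -
    have "(\<Sum>l=2^i..<2^Suc i. \<bar>1\<bar> * \<bar>norm (v l)\<bar>)
        \<le> L2_set (\<lambda>l::nat. 1) {2^i..<2^Suc i} * L2_set (\<lambda>l. norm (v l)) {2^i..<2^Suc i}"
      by (rule L2_set_mult_ineq)
    also have "L2_set (\<lambda>l. norm (v l)) {2^i..<2^Suc i}
        = L2_set (\<lambda>l. norm (if 2^i \<le> l then v l else 0)) {2^i..<2^Suc i}"
      by (rule L2_set_cong) auto
    also have "\<dots> \<le> tail v (2^i)"
      unfolding tail_def by (intro L2_set_le_l2norm l2_tail v) auto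
    also have "\<dots> \<le> C * real (2^i) powr (- a)" by (rule C(2)) simp
    also have "L2_set (\<lambda>l::nat. 1) {2^i..<2^Suc i} = real (2^i) powr (1 / 2)"
      by (simp add: L2_set_def powr_half_sqrt)
    finally have "(\<Sum>l=2^i..<2^Suc i. norm (v l)) \<le> real (2^i) powr (1 / 2) * (C * real (2^i) powr (- a))"
      by (simp add: mult_left_mono)
    also have "\<dots> = C * real (2^i) powr (1 / 2 - a)"
      by (simp add: powr_add[symmetric])
    also have "real (2^i) powr (1 / 2 - a) = q ^ i"
      by (simp add: q_def powr_realpow[symmetric] powr_powr mult.commute)
    finally show ?thesis .
  qed
  have dyadic: "(\<Sum>l<2^k. norm (v l)) \<le> norm (v 0) + C * (\<Sum>i<k. q ^ i)" for k
  proof (induction k)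
    case (Suc k)
    have "(\<Sum>l<2^Suc k. norm (v l)) = (\<Sum>l<2^k. norm (v l)) + (\<Sum>l=2^k..<2^Suc k. norm (v l))"
      unfolding lessThan_atLeast0 by (rule sum.atLeastLessThan_concat[symmetric]) auto
    with Suc block[of k] show ?case by (simp add: algebra_simps)
  qed simp
  have maxq: "max 1 q = 2 powr e"
  proof (cases "a \<le> 1 / 2")
    case True
    then have "q \<ge> 1" unfolding q_def by (intro ge_one_powr_ge_zero) auto
    with True show ?thesis by (simp add: e_def q_def)
  next
    case False
    then have "q < 1" unfolding q_def by (intro powr_less_one) auto
    with False show ?thesis by (simp add: e_def)
  qed
  define D where "D = norm (v 0) + C * 2 powr e / \<bar>q - 1\<bar>"
  have "(\<Sum>l<N. norm (v l)) \<le> D * real N powr e" if N: "N \<ge> 1" for N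
  proof -
    obtain k where k: "2 ^ k \<le> N" "N < 2 ^ (k + 1)"
      using ex_power_ivl1[of 2 N] N by auto
    let ?k = "Suc k"
    have geo: "(\<Sum>i<?k. q ^ i) \<le> max 1 q ^ ?k / \<bar>q - 1\<bar>"
    proof -
      have "(\<Sum>i<?k. q ^ i) = (q ^ ?k - 1) / (q - 1)" by (rule geometric_sum[OF q(2)])
      also have "\<dots> \<le> \<bar>q ^ ?k - 1\<bar> / \<bar>q - 1\<bar>" by (metis abs_divide abs_ge_self)
      also have "\<dots> \<le> max 1 q ^ ?k / \<bar>q - 1\<bar>"
      proof (rule divide_right_mono)
        have "q ^ ?k \<le> max 1 q ^ ?k" using q by (intro power_mono) auto
        moreover have "1 \<le> max 1 q ^ ?k" by (intro one_le_power) auto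
        moreover have "q ^ ?k \<ge> 0" using q by simp
        ultimately show "\<bar>q ^ ?k - 1\<bar> \<le> max 1 q ^ ?k" by linarith
      qed simp
      finally show ?thesis .
    qed
    have "max 1 q ^ ?k = (2 ^ ?k) powr e"
      unfolding maxq by (simp add: powr_realpow[symmetric] powr_powr mult.commute del: power_Suc)
    also have "\<dots> \<le> (2 * real N) powr e"
    proof (rule powr_mono2)
      have "real (2 ^ k) \<le> real N" using k(1) by (rule of_nat_mono)
      then show "2 ^ ?k \<le> 2 * real N" by simp
    qed (auto simp: e_def)
    also have "\<dots> = 2 powr e * real N powr e" by (simp add: powr_mult)
    finally have maxk: "max 1 q ^ ?k \<le> 2 powr e * real N powr e" .
    have "(\<Sum>l<N. norm (v l)) \<le> (\<Sum>l<2^?k. norm (v l))"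
      using k(2) by (intro sum_mono2) auto
    also have "\<dots> \<le> norm (v 0) + C * (\<Sum>i<?k. q ^ i)" by (rule dyadic)
    also have "\<dots> \<le> norm (v 0) * real N powr e + C * (2 powr e * real N powr e / \<bar>q - 1\<bar>)"
    proof (rule add_mono)
      have "1 \<le> real N powr e" using N by (simp add: e_def ge_one_powr_ge_zero)
      then show "norm (v 0) \<le> norm (v 0) * real N powr e"
        using mult_left_mono[of 1 "real N powr e" "norm (v 0)"] by simp
      have "(\<Sum>i<?k. q ^ i) \<le> 2 powr e * real N powr e / \<bar>q - 1\<bar>"
        using geo divide_right_mono[OF maxk, of "\<bar>q - 1\<bar>"] by linarith
      then show "C * (\<Sum>i<?k. q ^ i) \<le> C * (2 powr e * real N powr e / \<bar>q - 1\<bar>)"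
        by (rule mult_left_mono[OF _ C(1)])
    qed
    also have "\<dots> = D * real N powr e" by (simp add: D_def algebra_simps)
    finally show ?thesis .
  qed
  moreover have "D \<ge> 0" using C(1) by (simp add: D_def)
  ultimately show ?thesis unfolding e_def by blast
qed

section \<open>The canonical dual of a localized frame inherits the decay\<close>

text \<open>The cutoff rises linearly over an interval of length \<open>2 N\<close>: a sharp cutoff has too large a
  commutator with the Gram operator.\<close>

definition ramp :: "nat \<Rightarrow> nat \<Rightarrow> real"
  where "ramp N j = max 0 (min 1 ((real j - 2 * real N) / (2 * real N)))"

lemma ramp_range: "0 \<le> ramp N j \<and> ramp N j \<le> 1"
  by (auto simp: ramp_def)

lemma ramp_eq_0: "j \<le> 2 * N \<Longrightarrow> ramp N j = 0"
  using divide_nonpos_nonneg[of "real j - 2 * real N" "2 * real N"] by (simp add: ramp_def)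

lemma ramp_eq_1: "N \<ge> 1 \<Longrightarrow> 4 * N \<le> j \<Longrightarrow> ramp N j = 1"
  by (auto simp: ramp_def field_simps)

lemma ramp_Lipschitz:
  assumes "N \<ge> 1"
  shows "\<bar>ramp N j - ramp N l\<bar> \<le> min 1 (\<bar>real j - real l\<bar> / real N)"
proof -
  let ?x = "(real j - 2 * real N) / (2 * real N)" and ?y = "(real l - 2 * real N) / (2 * real N)"
  have "\<bar>ramp N j - ramp N l\<bar> \<le> \<bar>?x - ?y\<bar>" unfolding ramp_def by linarith
  also have "?x - ?y = (real j - real l) / (2 * real N)" by (simp add: diff_divide_distrib)
  also have "\<bar>\<dots>\<bar> \<le> \<bar>real j - real l\<bar> / real N"
    using assms by (simp add: abs_divide field_simps)
  finally show ?thesis using ramp_range[of N j] ramp_range[of N l] by auto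
qed

lemma ramp_Hoelder:
  assumes N: "N \<ge> 1" and d: "0 < d" "d \<le> 1"
  shows "\<bar>ramp N j - ramp N l\<bar> \<le> real N powr (- d) * (1 + \<bar>real j - real l\<bar>) powr d"
proof -
  define r where "r = \<bar>real j - real l\<bar> / real N"
  have r: "r \<ge> 0" by (simp add: r_def)
  have "min 1 r \<le> r powr d"
  proof (cases "r \<ge> 1")
    case True
    then show ?thesis using d by (simp add: ge_one_powr_ge_zero)
  next
    case False
    then show ?thesis using powr_mono'[of d 1 r] r d by simp
  qed
  also have "r powr d \<le> ((1 + \<bar>real j - real l\<bar>) / real N) powr d"
    unfolding r_def using d by (intro powr_mono2 divide_right_mono) auto
  also have "\<dots> = real N powr (- d) * (1 + \<bar>real j - real l\<bar>) powr d"
    using N by (simp add: powr_divide powr_minus field_simps)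
  finally show ?thesis using ramp_Lipschitz[OF N, of j l] unfolding r_def by linarith
qed

locale localized_frame = hilbert_frame smul ip \<phi> A B
  for smul :: "'k::hilbert_scalar \<Rightarrow> 'a::{banach, second_countable_topology} \<Rightarrow> 'a"
    and ip :: "'a \<Rightarrow> 'a \<Rightarrow> 'k" and \<phi> :: "nat \<Rightarrow> 'a" and A B :: real +
  fixes c0 s :: real
  assumes c0_pos: "c0 > 0" and s_gt_1: "s > 1"
    and gram_decay: "norm (ip (\<phi> j) (\<phi> l)) \<le> c0 * (1 + \<bar>real j - real l\<bar>) powr (- s)"
begin

text \<open>The Hoelder exponent at which the Lipschitz bound of the cutoff is used: at most 1, and below
  \<open>s - 1\<close> so that \<open>(1 + \<bar>j - l\<bar>) powr (\<delta> - s)\<close> still has bounded row sums.\<close>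

definition \<delta> :: real where "\<delta> = min 1 (s - 1) / 2"

lemma \<delta>: "0 < \<delta>" "\<delta> \<le> 1 / 2" "\<delta> < s - 1"
  using s_gt_1 by (auto simp: \<delta>_def min_def)

definition comm_const :: real
  where "comm_const = c0 * (1 + 2 / (s - \<delta> - 1)) + c0 / sqrt (2 * s - 1)"

lemma comm_const_nonneg: "comm_const \<ge> 0"
  unfolding comm_const_def using \<delta> c0_pos s_gt_1 by (intro add_nonneg_nonneg mult_nonneg_nonneg) auto

text \<open>The kernel of the commutator is \<open>(\<omega> j - \<omega> l) \<langle>\<phi> l, \<phi> j\<rangle>\<close>. For \<open>l \<ge> N\<close> the Hoelder bound on the cutoff
  gains the factor \<open>N powr (- \<delta>)\<close> and Schur's test applies to what remains. For \<open>l < N\<close> the kernel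
  vanishes unless \<open>j \<ge> 2 N\<close>, so that only entries at distance at least \<open>j - N\<close> from the diagonal are
  seen; their columns have norm of order \<open>N powr (1 / 2 - s)\<close>.\<close>

lemma comm_partial_sum_bound:
  assumes N: "N \<ge> 1"
  shows "L2_set (\<lambda>j. norm (\<Sum>l<L. (ramp N j - ramp N l) *\<^sub>R (coef h l * ip (\<phi> l) (\<phi> j)))) {..<n}
    \<le> comm_const * (real N powr (- \<delta>) * tail (coef h) N
        + real N powr (- (s - 1 / 2)) * (\<Sum>l<N. norm (coef h l)))"
proof -
  define V where "V = (\<Sum>l<N. norm (coef h l))"
  define u where "u l = norm (if N \<le> l then coef h l else 0)" for l
  define \<kappa> where "\<kappa> j l = (c0 * real N powr (- \<delta>)) * (1 + \<bar>real j - real l\<bar>) powr (- (s - \<delta>))" for j l :: nat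
  define k where "k j = (if 2 * N \<le> j then c0 * (1 + (real j - real N)) powr (- s) else 0)" for j
  have V: "V \<ge> 0" unfolding V_def by (simp add: sum_nonneg)
  have k_nonneg: "k j \<ge> 0" for j using c0_pos by (simp add: k_def)
  have \<kappa>_nonneg: "\<kappa> j l \<ge> 0" for j l using c0_pos by (simp add: \<kappa>_def)
  have u_nonneg: "u l \<ge> 0" for l by (simp add: u_def)
  have entry: "norm ((ramp N j - ramp N l) *\<^sub>R (coef h l * ip (\<phi> l) (\<phi> j)))
      \<le> k j * (if l < N then norm (coef h l) else 0) + \<kappa> j l * u l" for j l
  proof -
    let ?g = "c0 * (1 + \<bar>real j - real l\<bar>) powr (- s)"
    have "norm (ip (\<phi> l) (\<phi> j)) \<le> ?g" using gram_decay[of j l] by (simp add: norm_ip_commute)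
    then have le: "norm ((ramp N j - ramp N l) *\<^sub>R (coef h l * ip (\<phi> l) (\<phi> j)))
        \<le> \<bar>ramp N j - ramp N l\<bar> * (norm (coef h l) * ?g)"
      by (simp add: norm_mult mult_left_mono)
    show ?thesis
    proof (cases "l < N")
      case True
      have "\<bar>ramp N j - ramp N l\<bar> * ?g \<le> k j"
      proof (cases "2 * N \<le> j")
        case j: True
        have "\<bar>ramp N j - ramp N l\<bar> * ?g \<le> 1 * ?g"
          using ramp_range[of N j] ramp_range[of N l] c0_pos by (intro mult_right_mono) auto
        also have "?g \<le> c0 * (1 + (real j - real N)) powr (- s)"
          using True j s_gt_1 c0_pos by (intro mult_left_mono powr_mono2') auto
        finally show ?thesis using j by (simp add: k_def)
      next
        case False
        then have "ramp N j = 0" "ramp N l = 0" using True by (auto intro: ramp_eq_0)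
        then show ?thesis using k_nonneg[of j] by simp
      qed
      then have "\<bar>ramp N j - ramp N l\<bar> * ?g * norm (coef h l) \<le> k j * norm (coef h l)"
        by (rule mult_right_mono) simp
      with le True show ?thesis by (simp add: u_def mult_ac)
    next
      case False
      have "\<bar>ramp N j - ramp N l\<bar> * ?g
          \<le> (real N powr (- \<delta>) * (1 + \<bar>real j - real l\<bar>) powr \<delta>) * ?g"
        using ramp_Hoelder[OF N, of \<delta> j l] \<delta> c0_pos by (intro mult_right_mono) auto
      also have "\<dots> = (c0 * real N powr (- \<delta>)) * ((1 + \<bar>real j - real l\<bar>) powr \<delta> * (1 + \<bar>real j - real l\<bar>) powr (- s))"
        by simp
      also have "\<dots> = \<kappa> j l" by (simp add: \<kappa>_def powr_add[symmetric])
      finally have "\<bar>ramp N j - ramp N l\<bar> * ?g * norm (coef h l) \<le> \<kappa> j l * norm (coef h l)"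
        by (rule mult_right_mono) simp
      with le False show ?thesis by (simp add: u_def mult_ac)
    qed
  qed
  have row: "norm (\<Sum>l<L. (ramp N j - ramp N l) *\<^sub>R (coef h l * ip (\<phi> l) (\<phi> j)))
      \<le> V * k j + (\<Sum>l<L. \<kappa> j l * u l)" for j
  proof -
    have "norm (\<Sum>l<L. (ramp N j - ramp N l) *\<^sub>R (coef h l * ip (\<phi> l) (\<phi> j)))
        \<le> (\<Sum>l<L. k j * (if l < N then norm (coef h l) else 0) + \<kappa> j l * u l)"
      by (rule sum_norm_le) (rule entry)
    also have "\<dots> = k j * (\<Sum>l<L. if l < N then norm (coef h l) else 0) + (\<Sum>l<L. \<kappa> j l * u l)"
      by (simp add: sum.distrib sum_distrib_left)
    also have "(\<Sum>l<L. if l < N then norm (coef h l) else 0) = (\<Sum>l\<in>{..<L} \<inter> {..<N}. norm (coef h l))"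
      by (rule sum.mono_neutral_cong_right) auto
    also have "k j * \<dots> \<le> k j * V"
      unfolding V_def by (intro mult_left_mono sum_mono2 k_nonneg) auto
    finally show ?thesis by (simp add: mult.commute)
  qed
  have near: "L2_set k {..<n} \<le> c0 / sqrt (2 * s - 1) * real N powr (- (s - 1 / 2))"
  proof -
    have sq: "(c0 * (1 + (real j - real N)) powr (- s))\<^sup>2
        = c0\<^sup>2 * (1 + (real j - real N)) powr (- (2 * s - 1) - 1)" for j
      by (simp add: power_mult_distrib powr_square)
    have "(\<Sum>j<n. (k j)\<^sup>2) = (\<Sum>j=2*N..<n. (c0 * (1 + (real j - real N)) powr (- s))\<^sup>2)"
      by (rule sum.mono_neutral_cong_right) (auto simp: k_def)
    also have "\<dots> \<le> c0\<^sup>2 * ((real (2 * N) - real N) powr (- (2 * s - 1)) / (2 * s - 1))"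
      unfolding sq sum_distrib_left[symmetric]
      using N s_gt_1 by (intro mult_left_mono sum_powr_shift_le) auto
    also have "\<dots> = (c0 / sqrt (2 * s - 1) * real N powr (- (s - 1 / 2)))\<^sup>2"
      using s_gt_1 N by (simp add: power_mult_distrib power_divide powr_square algebra_simps)
    finally have "sqrt (\<Sum>j<n. (k j)\<^sup>2) \<le> \<bar>c0 / sqrt (2 * s - 1) * real N powr (- (s - 1 / 2))\<bar>"
      by (metis real_sqrt_le_mono real_sqrt_abs)
    moreover have "c0 / sqrt (2 * s - 1) * real N powr (- (s - 1 / 2)) \<ge> 0"
      using c0_pos s_gt_1 by simp
    ultimately show ?thesis unfolding L2_set_def by linarith
  qed
  have far: "L2_set (\<lambda>j. \<Sum>l<L. \<kappa> j l * u l) {..<n}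
      \<le> (c0 * real N powr (- \<delta>)) * (1 + 2 / (s - \<delta> - 1)) * tail (coef h) N"
  proof -
    let ?M = "(c0 * real N powr (- \<delta>)) * (1 + 2 / (s - \<delta> - 1))"
    have M: "?M \<ge> 0" using \<delta> c0_pos by simp
    have sum_le: "(\<Sum>l<m. \<kappa> j l) \<le> ?M" for j m
      unfolding \<kappa>_def sum_distrib_left[symmetric]
      using sum_powr_dist_le[of "s - \<delta>" j m] \<delta> c0_pos by (intro mult_left_mono) auto
    have sym: "\<kappa> j l = \<kappa> l j" for j l by (simp add: \<kappa>_def abs_minus_commute)
    have "L2_set (\<lambda>j. \<Sum>l<L. \<kappa> j l * u l) {..<n} \<le> ?M * L2_set u {..<L}"
    proof (rule Schur_test[OF \<kappa>_nonneg M])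
      show "(\<Sum>l<L. \<kappa> j l) \<le> ?M" for j by (rule sum_le)
      show "(\<Sum>j<n. \<kappa> j l) \<le> ?M" for l using sum_le[of l n] by (simp add: sym[of _ l])
    qed
    also have "\<dots> \<le> ?M * tail (coef h) N"
      unfolding tail_def u_def by (intro mult_left_mono L2_set_le_l2norm l2_tail l2_coef M) auto
    finally show ?thesis .
  qed
  have "L2_set (\<lambda>j. norm (\<Sum>l<L. (ramp N j - ramp N l) *\<^sub>R (coef h l * ip (\<phi> l) (\<phi> j)))) {..<n}
      \<le> L2_set (\<lambda>j. V * k j + (\<Sum>l<L. \<kappa> j l * u l)) {..<n}"
    by (rule L2_set_mono) (use row in auto)
  also have "\<dots> \<le> L2_set (\<lambda>j. V * k j) {..<n} + L2_set (\<lambda>j. \<Sum>l<L. \<kappa> j l * u l) {..<n}"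
    by (rule L2_set_triangle_ineq)
  also have "L2_set (\<lambda>j. V * k j) {..<n} = V * L2_set k {..<n}"
    using V by (rule L2_set_right_distrib[symmetric])
  also have "\<dots> + L2_set (\<lambda>j. \<Sum>l<L. \<kappa> j l * u l) {..<n}
      \<le> V * (c0 / sqrt (2 * s - 1) * real N powr (- (s - 1 / 2)))
        + (c0 * real N powr (- \<delta>)) * (1 + 2 / (s - \<delta> - 1)) * tail (coef h) N"
    by (intro add_mono mult_left_mono near far V)
  also have "\<dots> = c0 / sqrt (2 * s - 1) * (real N powr (- (s - 1 / 2)) * V)
      + c0 * (1 + 2 / (s - \<delta> - 1)) * (real N powr (- \<delta>) * tail (coef h) N)"
    by simp
  also have "\<dots> \<le> comm_const * (real N powr (- (s - 1 / 2)) * V)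
      + comm_const * (real N powr (- \<delta>) * tail (coef h) N)"
    using c0_pos s_gt_1 \<delta> V tail_nonneg[OF l2_coef, of h N] unfolding comm_const_def
    by (intro add_mono mult_right_mono) auto
  finally show ?thesis unfolding V_def by (simp add: algebra_simps)
qed

lemma comm_ramp_bound:
  assumes N: "N \<ge> 1"
  shows "l2norm (comm (ramp N) h)
    \<le> comm_const * (real N powr (- \<delta>) * tail (coef h) N
        + real N powr (- (s - 1 / 2)) * (\<Sum>l<N. norm (coef h l)))"
proof (rule l2_bounded(2), rule LIMSEQ_le_const2)
  fix n
  show "(\<lambda>L. L2_set (\<lambda>j. norm (\<Sum>l<L. (ramp N j - ramp N l) *\<^sub>R (coef h l * ip (\<phi> l) (\<phi> j)))) {..<n})
      \<longlonglongrightarrow> L2_set (\<lambda>j. norm (comm (ramp N) h j)) {..<n}"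
    using comm_sums[OF ramp_range[of N], where h = h] unfolding L2_set_def sums_def
    by (intro tendsto_real_sqrt tendsto_sum tendsto_power tendsto_norm)
qed (use comm_partial_sum_bound[OF N] in blast)

lemma tail_estimate:
  assumes N: "N \<ge> 1"
  defines "R h \<equiv> real N powr (- \<delta>) * tail (coef h) N
        + real N powr (- (s - 1 / 2)) * (\<Sum>l<N. norm (coef h l))"
  shows "tail (coef (S h)) (4 * N) \<le> (B / A\<^sup>2 + B / A + 1) *
    (tail (coef (S (S h))) (2 * N) + comm_const * R (S h) + comm_const * R h)"
proof -
  let ?K = "B / A\<^sup>2 + B / A + 1"
  have "tail (coef (S h)) (4 * N) \<le> l2norm (cut (ramp N) (S h))"
    unfolding tail_def using N ramp_range
    by (intro l2_mono(2) l2_cut) (auto simp: cut_def ramp_eq_1)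
  also have "\<dots> \<le> ?K * (l2norm (cut (ramp N) (S (S h)))
      + l2norm (comm (ramp N) (S h)) + l2norm (comm (ramp N) h))"
    by (rule cutoff_estimate[OF ramp_range])
  also have "\<dots> \<le> ?K * (tail (coef (S (S h))) (2 * N) + comm_const * R (S h) + comm_const * R h)"
  proof (intro mult_left_mono add_mono)
    show "l2norm (cut (ramp N) (S (S h))) \<le> tail (coef (S (S h))) (2 * N)"
      unfolding tail_def using ramp_range
      by (intro l2_mono(2) l2_tail l2_coef) (auto simp: cut_def ramp_eq_0 mult_left_le_one_le)
    show "0 \<le> ?K" using A_pos B_pos by simp
  qed (unfold R_def, (rule comm_ramp_bound[OF N])+)
  finally show ?thesis .
qed

text \<open>The commutator terms of \<open>tail_estimate\<close> beat the known decay by \<open>N powr (- \<delta>)\<close>, until the limit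
  \<open>s - 1 / 2\<close> set by the far-off-diagonal entries is reached. They involve the next preimage
  \<open>g (i + 2)\<close>, so the known decay is assumed for all preimages at once; the improved decay is
  passed on from \<open>g i\<close> to \<open>g (i + 1)\<close> by induction.\<close>

lemma tail_decay_step:
  assumes g: "\<And>i. S (g (Suc i)) = g i" and g0: "tail_decay (s - 1 / 2) (coef (g 0))"
    and dec: "\<And>i. tail_decay a (coef (g i))" and a: "a \<ge> 0" "a \<noteq> 1 / 2"
  shows "tail_decay (min (a + \<delta>) (s - 1 / 2)) (coef (g i))"
proof (induction i)
  case 0
  then show ?case using tail_decay_mono[OF g0] by simp
next
  case (Suc i)
  define b where "b = min (a + \<delta>) (s - 1 / 2)"
  define e where "e = max 0 (1 / 2 - a)"
  have b: "b \<ge> 0" "b \<le> a + \<delta>" "e - (s - 1 / 2) \<le> - b"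
    using a \<delta> s_gt_1 by (auto simp: b_def e_def)
  have R: "\<exists>C\<ge>0. \<forall>N\<ge>1. real N powr (- \<delta>) * tail (coef (g k)) N
        + real N powr (- (s - 1 / 2)) * (\<Sum>l<N. norm (coef (g k) l)) \<le> C * real N powr (- b)" for k
  proof -
    obtain C where C: "C \<ge> 0" "\<And>N. N \<ge> 1 \<Longrightarrow> tail (coef (g k)) N \<le> C * real N powr (- a)"
      using dec[of k] unfolding tail_decay_def by blast
    obtain D where D: "D \<ge> 0" "\<And>N. N \<ge> 1 \<Longrightarrow> (\<Sum>l<N. norm (coef (g k) l)) \<le> D * real N powr e"
      using partial_sums_of_tail_decay[OF dec[of k] a(2)] unfolding e_def by blast
    have "real N powr (- \<delta>) * tail (coef (g k)) N
        + real N powr (- (s - 1 / 2)) * (\<Sum>l<N. norm (coef (g k) l)) \<le> (C + D) * real N powr (- b)"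
      if N: "N \<ge> 1" for N
    proof -
      have "real N powr (- \<delta>) * tail (coef (g k)) N
          + real N powr (- (s - 1 / 2)) * (\<Sum>l<N. norm (coef (g k) l))
          \<le> real N powr (- \<delta>) * (C * real N powr (- a))
          + real N powr (- (s - 1 / 2)) * (D * real N powr e)"
        by (intro add_mono mult_left_mono C(2) D(2) N) auto
      also have "\<dots> = C * real N powr (- (a + \<delta>)) + D * real N powr (e - (s - 1 / 2))"
        by (simp add: powr_add[symmetric] algebra_simps)
      also have "\<dots> \<le> C * real N powr (- b) + D * real N powr (- b)"
        using N b by (intro add_mono mult_left_mono powr_mono C(1) D(1)) auto
      finally show ?thesis by (simp add: algebra_simps)
    qed
    then show ?thesis using C(1) D(1) by (intro exI[of _ "C + D"]) auto
  qed
  obtain C1 where C1: "C1 \<ge> 0" "\<And>N. N \<ge> 1 \<Longrightarrow> real N powr (- \<delta>) * tail (coef (g (Suc i))) N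
        + real N powr (- (s - 1 / 2)) * (\<Sum>l<N. norm (coef (g (Suc i)) l)) \<le> C1 * real N powr (- b)"
    using R[of "Suc i"] by blast
  obtain C2 where C2: "C2 \<ge> 0" "\<And>N. N \<ge> 1 \<Longrightarrow> real N powr (- \<delta>) * tail (coef (g (Suc (Suc i)))) N
        + real N powr (- (s - 1 / 2)) * (\<Sum>l<N. norm (coef (g (Suc (Suc i))) l)) \<le> C2 * real N powr (- b)"
    using R[of "Suc (Suc i)"] by blast
  obtain C0 where C0: "C0 \<ge> 0" "\<And>N. N \<ge> 1 \<Longrightarrow> tail (coef (g i)) N \<le> C0 * real N powr (- b)"
    using Suc unfolding tail_decay_def b_def by blast
  let ?K = "B / A\<^sup>2 + B / A + 1"
  have K: "?K \<ge> 0" using A_pos B_pos by simp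
  have "tail_decay b (coef (g (Suc i)))"
  proof (rule tail_decay_of_multiples[OF l2_coef b(1)])
    have "0 \<le> C0 + comm_const * C1 + comm_const * C2"
      using C0(1) C1(1) C2(1) comm_const_nonneg by simp
    then show "0 \<le> ?K * (C0 + comm_const * C1 + comm_const * C2)"
      by (rule mult_nonneg_nonneg[OF K])
    fix N :: nat assume N: "N \<ge> 1"
    have "tail (coef (g i)) (2 * N) \<le> C0 * real (2 * N) powr (- b)" using N by (intro C0(2)) simp
    also have "\<dots> \<le> C0 * real N powr (- b)"
      using N b C0(1) by (intro mult_left_mono powr_mono2') auto
    finally have t: "tail (coef (g i)) (2 * N) \<le> C0 * real N powr (- b)" .
    have "tail (coef (g (Suc i))) (4 * N) \<le> ?K * (C0 * real N powr (- b)
        + comm_const * (C1 * real N powr (- b)) + comm_const * (C2 * real N powr (- b)))"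
      using tail_estimate[OF N, of "g (Suc (Suc i))"] unfolding g
      by (rule order_trans) (intro mult_left_mono add_mono t C1(2) C2(2) N K comm_const_nonneg)
    then show "tail (coef (g (Suc i))) (4 * N)
        \<le> ?K * (C0 + comm_const * C1 + comm_const * C2) * real N powr (- b)"
      by (simp add: algebra_simps)
  qed
  then show ?case by (simp only: b_def)
qed

text \<open>The inverse of the frame operator preserves the decay rate \<open>s - 1 / 2\<close> of the coefficients. Start
  from mere square-summability and improve the exponent repeatedly. Each step is counted as a gain
  of \<open>\<delta> / 2\<close>, so that there is room to step back to \<open>1 / 2 - \<delta> / 2\<close> when the exponent is exactly
  \<open>1 / 2\<close>, the value that \<open>tail_decay_step\<close> excludes.\<close>

lemma tail_decay_inverse_frame_operator:
  assumes g: "\<And>i. S (g (Suc i)) = g i" and g0: "tail_decay (s - 1 / 2) (coef (g 0))"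
  shows "tail_decay (s - 1 / 2) (coef (g i))"
proof -
  have "tail_decay (min (real k * (\<delta> / 2)) (s - 1 / 2)) (coef (g i))" for k i
  proof (induction k arbitrary: i)
    case 0
    then show ?case using s_gt_1 by (simp add: tail_decay_zero l2_coef)
  next
    case (Suc k)
    define a where "a = min (real k * (\<delta> / 2)) (s - 1 / 2)"
    have a: "a \<ge> 0" using \<delta> s_gt_1 by (simp add: a_def)
    have dec: "tail_decay a (coef (g i))" for i unfolding a_def by (rule Suc)
    show ?case
    proof (cases "a = 1 / 2")
      case True
      have "tail_decay (1 / 2 - \<delta> / 2) (coef (g i))" for i
        by (rule tail_decay_mono[OF dec]) (use True \<delta> in simp)
      then have "tail_decay (min (1 / 2 - \<delta> / 2 + \<delta>) (s - 1 / 2)) (coef (g i))"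
        using \<delta> by (intro tail_decay_step[OF g g0]) auto
      moreover have "real k * (\<delta> / 2) = 1 / 2"
        using True s_gt_1 unfolding a_def min_def by (auto split: if_splits)
      then have "real (Suc k) * (\<delta> / 2) = 1 / 2 - \<delta> / 2 + \<delta>" by (simp add: algebra_simps)
      ultimately show ?thesis by (simp only:)
    next
      case False
      have "tail_decay (min (a + \<delta>) (s - 1 / 2)) (coef (g i))"
        by (rule tail_decay_step[OF g g0 dec a False])
      moreover have "real (Suc k) * (\<delta> / 2) = real k * (\<delta> / 2) + \<delta> / 2"
        by (simp add: algebra_simps)
      then have "min (real (Suc k) * (\<delta> / 2)) (s - 1 / 2) \<le> min (a + \<delta>) (s - 1 / 2)"
        using \<delta> unfolding a_def by linarith
      ultimately show ?thesis by (rule tail_decay_mono)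
    qed
  qed
  moreover obtain k where "s - 1 / 2 < real k * (\<delta> / 2)"
    using reals_Archimedean3[of "\<delta> / 2"] \<delta>(1) half_gt_zero by blast
  ultimately show ?thesis by (metis less_imp_le min.absorb2)
qed

end

section \<open>The smallest eigenvalue of a Gram matrix\<close>

text \<open>A quadratic polynomial that is nonnegative and vanishes at 0 has a critical point there.\<close>

lemma no_linear_term:
  fixes W Y :: real
  assumes "\<And>t. 0 \<le> 2 * t * W + t\<^sup>2 * Y" and "W \<ge> 0"
  shows "W = 0"
proof (rule ccontr)
  assume "W \<noteq> 0"
  with assms(2) have W: "W > 0" by simp
  define t where "t = - W / (\<bar>Y\<bar> + 1)"
  have t: "t < 0" using W by (simp add: t_def divide_neg_pos)
  have "\<bar>t * Y\<bar> = W * (\<bar>Y\<bar> / (\<bar>Y\<bar> + 1))" using W by (simp add: t_def abs_mult)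
  also have "\<dots> \<le> W * 1" using W by (intro mult_left_mono) (auto simp: field_simps)
  finally have "2 * W + t * Y > 0" using W by linarith
  then have "t * (2 * W + t * Y) < 0" using t by (simp add: mult_neg_pos)
  with assms(1)[of t] show False by (simp add: algebra_simps power2_eq_square)
qed

context hilbert_space
begin

lemma bounded_linear_smul_left: "bounded_linear (\<lambda>a. smul a x)"
proof (rule bounded_linear_intro[where K = "norm x"])
  show "smul (r *\<^sub>R a) x = r *\<^sub>R smul a x" for r a
    by (simp add: smul_of_real[symmetric] scaleR_conv_of_real)
qed (auto simp: scale_left_distrib norm_smul)

definition lincomb :: "(nat \<Rightarrow> 'a) \<Rightarrow> nat \<Rightarrow> (nat \<Rightarrow> 'k) \<Rightarrow> 'a"
  where "lincomb \<phi> n c = (\<Sum>l<n. smul (c l) (\<phi> l))"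

lemma lincomb_add: "lincomb \<phi> n (\<lambda>l. c l + d l) = lincomb \<phi> n c + lincomb \<phi> n d"
  by (simp add: lincomb_def scale_left_distrib sum.distrib)

lemma lincomb_mult: "lincomb \<phi> n (\<lambda>l. a * c l) = smul a (lincomb \<phi> n c)"
  by (simp add: lincomb_def scale_sum_right)

lemma span_eq_lincomb: "span (\<phi> ` {..<n}) = range (lincomb \<phi> n)"
proof
  have "subspace (range (lincomb \<phi> n))"
    unfolding subspace_def
  proof (intro conjI ballI allI)
    show "0 \<in> range (lincomb \<phi> n)" by (rule range_eqI[of _ _ "\<lambda>_. 0"]) (simp add: lincomb_def)
    show "x + y \<in> range (lincomb \<phi> n)" if "x \<in> range (lincomb \<phi> n)" "y \<in> range (lincomb \<phi> n)" for x y
      using that by (auto simp: lincomb_add[symmetric])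
    show "smul a x \<in> range (lincomb \<phi> n)" if "x \<in> range (lincomb \<phi> n)" for a x
      using that by (auto simp: lincomb_mult[symmetric])
  qed
  moreover have "\<phi> l \<in> range (lincomb \<phi> n)" if "l < n" for l
  proof (rule range_eqI[of _ _ "\<lambda>k. if k = l then 1 else 0"])
    have "lincomb \<phi> n (\<lambda>k. if k = l then 1 else 0) = (\<Sum>k<n. if k = l then \<phi> l else 0)"
      unfolding lincomb_def by (rule sum.cong) auto
    then show "\<phi> l = lincomb \<phi> n (\<lambda>k. if k = l then 1 else 0)" using that by simp
  qed
  ultimately show "span (\<phi> ` {..<n}) \<subseteq> range (lincomb \<phi> n)" by (intro span_minimal) auto
  show "range (lincomb \<phi> n) \<subseteq> span (\<phi> ` {..<n})"
    by (auto simp: lincomb_def intro!: span_sum span_scale intro: span_base)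
qed

lemma ip_lincomb_right: "ip x (lincomb \<phi> n c) = (\<Sum>l<n. cnjg (c l) * ip x (\<phi> l))"
proof -
  have "ip x (lincomb \<phi> n c) = cnjg (ip (lincomb \<phi> n c) x)" by (rule ip_commute)
  also have "\<dots> = (\<Sum>l<n. cnjg (c l) * ip x (\<phi> l))"
    by (simp add: lincomb_def ip_sum_left ip_smul_left cnjg_sum cnjg_mult ip_commute[of x "\<phi> _"])
  finally show ?thesis .
qed

text \<open>By Tychonoff's theorem, coefficient families bounded by 1 and vanishing from \<open>n\<close> on form a compact
  set in the product topology; its intersection with the unit sphere is compact as well.\<close>

lemma Rayleigh_minimum_exists:
  assumes n: "n \<ge> 1"
  obtains c \<mu> where "(\<Sum>l<n. (norm (c l))\<^sup>2) = 1" and "(norm (lincomb \<phi> n c))\<^sup>2 = \<mu>"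
    and "\<And>d. \<mu> * (\<Sum>l<n. (norm (d l))\<^sup>2) \<le> (norm (lincomb \<phi> n d))\<^sup>2"
proof -
  let ?N = "\<lambda>c::nat \<Rightarrow> 'k. \<Sum>l<n. (norm (c l))\<^sup>2" and ?Q = "\<lambda>c. (norm (lincomb \<phi> n c))\<^sup>2"
  define K where "K = (PiE UNIV (\<lambda>l. if l < n then cball 0 1 else {0}) :: (nat \<Rightarrow> 'k) set)"
  have "compactin (product_topology (\<lambda>l. euclidean) UNIV) K"
    unfolding K_def compactin_PiE by simp
  then have K: "compact K" by (simp add: euclidean_product_topology)
  have contN: "continuous_on UNIV ?N" by (intro continuous_intros) simp
  have contQ: "continuous_on UNIV ?Q"
    unfolding lincomb_def
    by (intro continuous_intros bounded_linear.continuous_on[OF bounded_linear_smul_left]) simp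
  define K1 where "K1 = K \<inter> {c. ?N c = 1}"
  have "compact K1"
    unfolding K1_def using contN by (intro compact_Int_closed[OF K] closed_Collect_eq) auto
  moreover have "K1 \<noteq> {}"
  proof -
    have "?N (\<lambda>l. if l = 0 then 1 else 0) = (\<Sum>l<n. if l = 0 then 1 else 0)"
      by (rule sum.cong) auto
    then have "(\<lambda>l. if l = 0 then 1 else 0) \<in> K1" using n by (auto simp: K1_def K_def)
    then show ?thesis by blast
  qed
  ultimately obtain c where c: "c \<in> K1" "\<And>d. d \<in> K1 \<Longrightarrow> ?Q c \<le> ?Q d"
    using continuous_attains_inf[of K1 ?Q] continuous_on_subset[OF contQ] by blast
  have "?Q c * ?N d \<le> ?Q d" for d
  proof (cases "?N d = 0")
    case False
    moreover have "?N d \<ge> 0" by (simp add: sum_nonneg)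
    ultimately have N: "?N d > 0" by simp
    define r where "r = 1 / sqrt (?N d)"
    have r: "r\<^sup>2 * ?N d = 1" using N by (simp add: r_def power_divide)
    define d' where "d' l = (if l < n then of_real r * d l else 0)" for l
    have "?N d' = r\<^sup>2 * ?N d"
      unfolding sum_distrib_left by (rule sum.cong) (auto simp: d'_def norm_mult power_mult_distrib)
    then have N': "?N d' = 1" using r by simp
    have "norm (d' l) \<le> 1" if "l < n" for l
    proof -
      have "(norm (d' l))\<^sup>2 \<le> ?N d'" using that by (intro member_le_sum) auto
      then show ?thesis using N' by (simp add: abs_square_le_1)
    qed
    then have "d' \<in> K1" using N' by (auto simp: K1_def K_def d'_def)
    then have "?Q c \<le> ?Q d'" by (rule c(2))
    also have "lincomb \<phi> n d' = smul (of_real r) (lincomb \<phi> n d)"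
      unfolding lincomb_mult[symmetric] by (simp add: lincomb_def d'_def)
    also have "(norm \<dots>)\<^sup>2 = r\<^sup>2 * ?Q d" by (simp add: norm_smul power_mult_distrib)
    finally have "?Q c * ?N d \<le> r\<^sup>2 * ?Q d * ?N d" using N by (intro mult_right_mono) auto
    also have "\<dots> = (r\<^sup>2 * ?N d) * ?Q d" by simp
    finally show ?thesis by (simp only: r mult_1)
  qed simp
  with c(1) show ?thesis by (intro that[of c "?Q c"]) (auto simp: K1_def)
qed

text \<open>First variation at a minimizer, in the direction of the residual \<open>w\<close> itself: for this choice the
  linear term is \<open>2 t \<parallel>w\<parallel>\<^sup>2\<close>, with no phase to adjust.\<close>

lemma Rayleigh_minimum_eigen:
  assumes c: "(norm (lincomb \<phi> n c))\<^sup>2 = \<mu> * (\<Sum>l<n. (norm (c l))\<^sup>2)"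
    and min: "\<And>d. \<mu> * (\<Sum>l<n. (norm (d l))\<^sup>2) \<le> (norm (lincomb \<phi> n d))\<^sup>2"
    and j: "j < n"
  shows "ip (lincomb \<phi> n c) (\<phi> j) = of_real \<mu> * c j"
proof -
  let ?L = "lincomb \<phi> n"
  define w where "w l = ip (?L c) (\<phi> l) - of_real \<mu> * c l" for l
  define W where "W = (\<Sum>l<n. (norm (w l))\<^sup>2)"
  define N where "N d = (\<Sum>l<n. (norm (d l))\<^sup>2)" for d :: "nat \<Rightarrow> 'k"
  have N: "of_real (N d) = (\<Sum>l<n. d l * cnjg (d l))" for d
    by (simp only: N_def of_real_sum mult_cnjg_of_real)
  define X where "X = ip (?L c) (?L w) - of_real \<mu> * (\<Sum>l<n. c l * cnjg (w l))"
  have "X = (\<Sum>l<n. w l * cnjg (w l))"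
    unfolding X_def ip_lincomb_right sum_distrib_left sum_subtractf[symmetric]
    by (rule sum.cong) (auto simp: w_def algebra_simps)
  then have X: "X = of_real W" by (simp only: W_def N_def[symmetric] N)
  have X': "ip (?L w) (?L c) - of_real \<mu> * (\<Sum>l<n. w l * cnjg (c l)) = of_real W"
  proof -
    have "ip (?L w) (?L c) - of_real \<mu> * (\<Sum>l<n. w l * cnjg (c l)) = cnjg X"
      by (simp add: X_def cnjg_diff cnjg_mult cnjg_sum cnjg_cnjg mult.commute
          ip_commute[of "?L w" "?L c"])
    then show ?thesis unfolding X by simp
  qed
  have "0 \<le> 2 * t * W + t\<^sup>2 * ((norm (?L w))\<^sup>2 - \<mu> * W)" for t
  proof -
    let ?d = "\<lambda>l. c l + of_real t * w l"
    have "ip (?L ?d) (?L ?d) - of_real \<mu> * (\<Sum>l<n. ?d l * cnjg (?d l))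
        = (ip (?L c) (?L c) - of_real \<mu> * (\<Sum>l<n. c l * cnjg (c l)))
        + of_real t * X + of_real t * (ip (?L w) (?L c) - of_real \<mu> * (\<Sum>l<n. w l * cnjg (c l)))
        + of_real t * of_real t * (ip (?L w) (?L w) - of_real \<mu> * (\<Sum>l<n. w l * cnjg (w l)))"
      unfolding lincomb_add lincomb_mult X_def
      by (simp add: ip_add_left ip_add_right ip_smul_left ip_smul_right cnjg_add cnjg_mult
          sum.distrib sum_distrib_left algebra_simps)
    also have "\<dots> = of_real (((norm (?L c))\<^sup>2 - \<mu> * N c) + t * W + t * W
        + t * t * ((norm (?L w))\<^sup>2 - \<mu> * W))"
      unfolding X X' ip_self N[symmetric] W_def N_def[symmetric]
      by simp
    also have "ip (?L ?d) (?L ?d) - of_real \<mu> * (\<Sum>l<n. ?d l * cnjg (?d l))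
        = of_real ((norm (?L ?d))\<^sup>2 - \<mu> * N ?d)"
      unfolding ip_self N[symmetric] by simp
    finally have "(norm (?L ?d))\<^sup>2 - \<mu> * N ?d = ((norm (?L c))\<^sup>2 - \<mu> * N c) + t * W + t * W
        + t * t * ((norm (?L w))\<^sup>2 - \<mu> * W)"
      by (simp only: of_real_eq_iff)
    moreover have "\<mu> * N ?d \<le> (norm (?L ?d))\<^sup>2" unfolding N_def by (rule min)
    moreover have "(norm (?L c))\<^sup>2 = \<mu> * N c" unfolding N_def by (rule c)
    ultimately show ?thesis unfolding power2_eq_square[of t] by linarith
  qed
  then have "W = 0" by (rule no_linear_term) (simp add: W_def sum_nonneg)
  then have "(norm (w j))\<^sup>2 = 0"
    unfolding W_def using j by (subst (asm) sum_nonneg_eq_0_iff) auto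
  then show ?thesis by (simp add: w_def)
qed

text \<open>The Gram matrix with entries \<open>\<langle>\<phi> j, \<phi> l\<rangle>\<close> acts on the conjugates of the coefficients, because the
  inner product is conjugate linear in its second argument.\<close>

lemma gram_mult_vec:
  assumes v: "v \<in> carrier_vec n" and j: "j < n"
  shows "(Matrix.mat n n (\<lambda>(j, l). ip (\<phi> j) (\<phi> l)) *\<^sub>v v) $ j = ip (\<phi> j) (lincomb \<phi> n (\<lambda>l. cnjg (v $ l)))"
  using v j
  by (simp add: ip_lincomb_right cnjg_cnjg scalar_prod_def lessThan_atLeast0 mult.commute)

text \<open>The minimum of the Rayleigh quotient is an eigenvalue, so the smallest eigenvalue is at most this
  minimum. It is positive because the Gram matrix is positive semidefinite and invertible.\<close>

lemma gram_lambda_min: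
  fixes \<phi> :: "nat \<Rightarrow> 'a"
  defines "G n \<equiv> Matrix.mat n n (\<lambda>(j, l). ip (\<phi> j) (\<phi> l))"
  assumes n: "n \<ge> 1" and inv: "invertible_mat (G n)"
  shows "lambda_min (G n) > 0"
    and "lambda_min (G n) * (\<Sum>l<n. (norm (c l))\<^sup>2) \<le> (norm (lincomb \<phi> n c))\<^sup>2"
proof -
  let ?G = "G n"
  have G: "?G \<in> carrier_mat n n" by (simp add: G_def)
  define E where "E = {r::real. eigenvalue ?G (of_real r)}"
  have finE: "finite E"
  proof -
    have "char_poly ?G \<noteq> 0" using degree_monic_char_poly[OF G] by auto
    then have "finite {k. poly (char_poly ?G) k = 0}" by (rule poly_roots_finite)
    then have "finite {k. eigenvalue ?G k}" unfolding eigenvalue_root_char_poly[OF G] .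
    moreover have "E = of_real -` {k. eigenvalue ?G k}" by (auto simp: E_def)
    ultimately show ?thesis by (metis finite_vimageI inj_of_real)
  qed
  obtain c0 \<mu> where c0: "(\<Sum>l<n. (norm (c0 l))\<^sup>2) = 1" "(norm (lincomb \<phi> n c0))\<^sup>2 = \<mu>"
    and min: "\<And>d. \<mu> * (\<Sum>l<n. (norm (d l))\<^sup>2) \<le> (norm (lincomb \<phi> n d))\<^sup>2"
    using Rayleigh_minimum_exists[OF n, of \<phi>] by metis
  have eig: "ip (lincomb \<phi> n c0) (\<phi> j) = of_real \<mu> * c0 j" if "j < n" for j
    using c0 min that by (intro Rayleigh_minimum_eigen) auto
  have "\<mu> \<in> E"
  proof -
    define v where "v = vec n (\<lambda>l. cnjg (c0 l))"
    have "v \<noteq> 0\<^sub>v n"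
    proof
      assume v0: "v = 0\<^sub>v n"
      have "c0 l = 0" if "l < n" for l
      proof -
        have "cnjg (c0 l) = 0" using arg_cong[OF v0, of "\<lambda>v. v $ l"] that by (simp add: v_def)
        then show ?thesis by (metis cnjg_cnjg cnjg_zero)
      qed
      then show False using c0(1) by simp
    qed
    moreover have "?G *\<^sub>v v = of_real \<mu> \<cdot>\<^sub>v v"
    proof (rule eq_vecI)
      fix j assume "j < dim_vec (of_real \<mu> \<cdot>\<^sub>v v)"
      then have j: "j < n" by (simp add: v_def)
      have "(?G *\<^sub>v v) $ j = ip (\<phi> j) (lincomb \<phi> n (\<lambda>l. cnjg (v $ l)))"
        unfolding G_def using j by (intro gram_mult_vec) (auto simp: v_def)
      also have "lincomb \<phi> n (\<lambda>l. cnjg (v $ l)) = lincomb \<phi> n c0"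
        by (simp add: lincomb_def v_def cnjg_cnjg)
      also have "ip (\<phi> j) (lincomb \<phi> n c0) = cnjg (of_real \<mu> * c0 j)"
        using eig[OF j] by (simp add: ip_commute[of "\<phi> j" "lincomb \<phi> n c0"])
      finally show "(?G *\<^sub>v v) $ j = (of_real \<mu> \<cdot>\<^sub>v v) $ j"
        using j by (simp add: v_def cnjg_mult)
    qed (simp add: v_def G_def)
    ultimately have "eigenvector ?G v (of_real \<mu>)" by (simp add: eigenvector_def v_def G_def)
    then show ?thesis by (auto simp: E_def eigenvalue_def)
  qed
  then have le: "lambda_min ?G \<le> \<mu>" and mem: "lambda_min ?G \<in> E"
    unfolding lambda_min_def E_def[symmetric] using finE by (auto intro: Min_in)
  have "lambda_min ?G * (\<Sum>l<n. (norm (c l))\<^sup>2) \<le> \<mu> * (\<Sum>l<n. (norm (c l))\<^sup>2)"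
    by (rule mult_right_mono[OF le]) (simp add: sum_nonneg)
  with min[of c] show "lambda_min ?G * (\<Sum>l<n. (norm (c l))\<^sup>2) \<le> (norm (lincomb \<phi> n c))\<^sup>2" by linarith
  define r where "r = lambda_min ?G"
  from mem obtain v where v: "v \<in> carrier_vec n" "v \<noteq> 0\<^sub>v n" and Gv: "?G *\<^sub>v v = of_real r \<cdot>\<^sub>v v"
    by (auto simp: E_def eigenvalue_def eigenvector_def G_def r_def)
  define d where "d l = cnjg (v $ l)" for l
  define h where "h = lincomb \<phi> n d"
  have ph: "ip (\<phi> j) h = of_real r * v $ j" if "j < n" for j
  proof -
    have "ip (\<phi> j) h = (?G *\<^sub>v v) $ j"
      unfolding h_def d_def G_def by (rule gram_mult_vec[OF v(1) that, symmetric])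
    then show ?thesis unfolding Gv using v(1) that by simp
  qed
  have "ip h h = (\<Sum>l<n. d l * ip (\<phi> l) h)"
    by (subst (1) h_def) (simp add: lincomb_def ip_sum_left ip_smul_left)
  also have "\<dots> = (\<Sum>l<n. of_real r * (v $ l * cnjg (v $ l)))"
    by (rule sum.cong) (auto simp: ph d_def)
  also have "\<dots> = of_real (r * (\<Sum>l<n. (norm (v $ l))\<^sup>2))"
    unfolding mult_cnjg_of_real by (simp add: sum_distrib_left)
  finally have "(norm h)\<^sup>2 = r * (\<Sum>l<n. (norm (v $ l))\<^sup>2)" unfolding ip_self by (simp only: of_real_eq_iff)
  moreover have "(\<Sum>l<n. (norm (v $ l))\<^sup>2) > 0"
  proof -
    obtain l where "l < n" "v $ l \<noteq> 0" using v by (auto simp: vec_eq_iff)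
    then show ?thesis by (intro sum_pos2[of _ l]) auto
  qed
  ultimately have "r \<ge> 0" by (metis zero_le_power2 zero_le_mult_iff not_less)
  moreover have "r \<noteq> 0"
  proof
    assume "r = 0"
    then have Gv0: "?G *\<^sub>v v = 0\<^sub>v n" using Gv v(1) by auto
    obtain H where H: "?G * H = 1\<^sub>m (dim_row ?G)" "H * ?G = 1\<^sub>m (dim_row H)"
      using inv unfolding invertible_mat_def inverts_mat_def by blast
    have "dim_col (?G * H) = n" "dim_col (H * ?G) = dim_row H" unfolding H using G by auto
    then have Hc: "H \<in> carrier_mat n n" using G by auto
    have "v = (H * ?G) *\<^sub>v v" unfolding H(2) using Hc v(1) by simp
    also have "\<dots> = H *\<^sub>v (?G *\<^sub>v v)" using Hc G v(1) by (rule assoc_mult_mat_vec)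
    also have "\<dots> = 0\<^sub>v n" unfolding Gv0 using Hc by (intro eq_vecI) auto
    finally show False using v(2) by simp
  qed
  ultimately show "lambda_min ?G > 0" by (simp add: r_def)
qed

end

section \<open>Finite sections of a localized frame\<close>

context hilbert_space
begin

lemma orth_proj_diff:
  assumes "finite F" and "M = span F"
  shows "orth_proj ip M (x - y) = orth_proj ip M x - orth_proj ip M y"
  using orth_proj_add[OF assms, of "x - y" y] by simp

text \<open>For a linear operator that is definite on a finite-dimensional space, a vector orthogonal
  to the range vanishes, so that the range is everything.\<close>

lemma definite_imp_bij_betw:
  assumes F: "finite F" "M = span F"
    and add: "\<And>x y. V (x + y) = V x + V y" and smul: "\<And>a x. V (smul a x) = smul a (V x)"
    and closed: "\<And>x. V x \<in> M"
    and definite: "\<And>x. x \<in> M \<Longrightarrow> ip (V x) x = 0 \<Longrightarrow> x = 0"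
  shows "bij_betw V M M"
proof -
  have V0: "V 0 = 0" using smul[of 0 0] by simp
  have diff: "V (x - y) = V x - V y" for x y using add[of "x - y" y] by (simp add: algebra_simps)
  have inj: "inj_on V M"
  proof (rule inj_onI)
    fix x y assume "x \<in> M" "y \<in> M" "V x = V y"
    then have "x - y \<in> M" "V (x - y) = 0" using F(2) by (auto simp: span_diff diff)
    then show "x = y" using definite[of "x - y"] by simp
  qed
  have sub: "subspace {x. V x \<in> span (V ` F)}"
    by (auto simp: subspace_def V0 add smul span_zero span_add span_scale)
  then have "M \<subseteq> {x. V x \<in> span (V ` F)}"
    unfolding F(2) by (intro span_minimal) (auto intro: span_base)
  then have range: "V x \<in> span (V ` F)" if "x \<in> M" for x using that by auto
  have "subspace (V ` M)"
    unfolding subspace_def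
  proof (intro conjI ballI allI)
    have M: "subspace M" unfolding F(2) by (rule subspace_span)
    show "0 \<in> V ` M" using V0 subspace_0[OF M] by (metis imageI)
    show "x + y \<in> V ` M" if "x \<in> V ` M" "y \<in> V ` M" for x y
      using that subspace_add[OF M] by (auto simp: add[symmetric])
    show "smul a x \<in> V ` M" if "x \<in> V ` M" for a x
      using that subspace_scale[OF M] by (auto simp: smul[symmetric])
  qed
  then have sub_image: "span (V ` F) \<subseteq> V ` M"
    using F(2) by (intro span_minimal) (auto intro: span_base)
  have "M \<subseteq> V ` M"
  proof
    fix h assume h: "h \<in> M"
    obtain p where p: "p \<in> span (V ` F)" "\<And>g. g \<in> span (V ` F) \<Longrightarrow> ip (h - p) g = 0"
      using projection_exists[of "V ` F" h] F(1) by blast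
    have "p \<in> M" using p(1) sub_image closed by blast
    then have M: "h - p \<in> M" using h F(2) by (simp add: span_diff)
    have "ip (h - p) (V (h - p)) = 0" using p(2) range M by blast
    then have "ip (V (h - p)) (h - p) = 0" by (simp add: ip_commute[of "V (h - p)" "h - p"])
    then have "h - p = 0" by (rule definite[OF M])
    then show "h \<in> V ` M" using p(1) sub_image by auto
  qed
  then have "V ` M = M" using closed by blast
  with inj show ?thesis by (simp add: bij_betw_def)
qed

end

lemma l2norm_split:
  assumes "l2 a"
  shows "(l2norm a)\<^sup>2 = (\<Sum>j<m. (norm (a j))\<^sup>2) + (tail a m)\<^sup>2"
proof -
  let ?f = "\<lambda>j. (norm (a j))\<^sup>2"
  have "(\<lambda>j. if j \<in> {..<m} then ?f j else 0) sums sum ?f {..<m}"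
    by (rule sums_If_finite_set) simp
  moreover have "(\<lambda>j. (norm (if m \<le> j then a j else 0))\<^sup>2) sums (tail a m)\<^sup>2"
    using l2_tail[OF assms, of m] unfolding tail_def l2norm_power2[OF l2_tail[OF assms]]
    by (simp add: l2_def summable_sums)
  ultimately have "(\<lambda>j. (if j \<in> {..<m} then ?f j else 0) + (norm (if m \<le> j then a j else 0))\<^sup>2)
      sums (sum ?f {..<m} + (tail a m)\<^sup>2)" by (rule sums_add)
  moreover have "(\<lambda>j. (if j \<in> {..<m} then ?f j else 0) + (norm (if m \<le> j then a j else 0))\<^sup>2) = ?f"
    by (auto simp: fun_eq_iff)
  ultimately show ?thesis unfolding l2norm_power2[OF assms] by (simp add: sums_iff)
qed

context hilbert_frame
begin

definition Sm :: "nat \<Rightarrow> 'a \<Rightarrow> 'a" where "Sm m h = (\<Sum>j<m. smul (coef h j) (\<phi> j))"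

lemma Sm_add: "Sm m (x + y) = Sm m x + Sm m y"
  by (simp add: Sm_def coef_def ip_add_left scale_left_distrib sum.distrib)

lemma Sm_diff: "Sm m (x - y) = Sm m x - Sm m y"
  using Sm_add[of m "x - y" y] by simp

lemma Sm_smul: "Sm m (smul a x) = smul a (Sm m x)"
  by (simp add: Sm_def coef_def ip_smul_left scale_sum_right)

lemma norm_Sm_le: "norm (Sm m x) \<le> B * norm x"
proof -
  have "norm (Sm m x) \<le> sqrt B * L2_set (\<lambda>j. norm (coef x j)) {..<m}"
    unfolding Sm_def by (rule norm_syn_finite) simp
  also have "\<dots> \<le> sqrt B * (sqrt B * norm x)"
    using L2_set_le_l2norm[OF l2_coef, of "{..<m}" x] coef_upper[of x] B_pos
    by (intro mult_left_mono) auto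
  also have "\<dots> = B * norm x" using B_pos by (simp add: mult.assoc[symmetric])
  finally show ?thesis .
qed

lemma norm_S_minus_Sm_le: "norm (S h - Sm m h) \<le> sqrt B * tail (coef h) m"
proof -
  let ?t = "\<lambda>j. if m \<le> j then coef h j else 0"
  have "(\<lambda>j. if j \<in> {..<m} then smul (coef h j) (\<phi> j) else 0) sums Sm m h"
    unfolding Sm_def by (rule sums_If_finite_set) simp
  then have "(\<lambda>j. smul (coef h j) (\<phi> j) - (if j \<in> {..<m} then smul (coef h j) (\<phi> j) else 0))
      sums (S h - Sm m h)"
    unfolding S_def by (intro sums_diff syn_sums l2_coef)
  moreover have "(\<lambda>j. smul (coef h j) (\<phi> j) - (if j \<in> {..<m} then smul (coef h j) (\<phi> j) else 0))
      = (\<lambda>j. smul (?t j) (\<phi> j))" by (auto simp: fun_eq_iff)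
  ultimately have "(\<lambda>j. smul (?t j) (\<phi> j)) sums (S h - Sm m h)" by simp
  then have "S h - Sm m h = syn ?t" by (rule sums_unique2) (intro syn_sums l2_tail l2_coef)
  then show ?thesis unfolding tail_def by (simp add: norm_syn_le l2_tail l2_coef)
qed

lemma ip_Sm_self: "ip (Sm m h) h = of_real ((l2norm (coef h))\<^sup>2 - (tail (coef h) m)\<^sup>2)"
proof -
  have "ip (Sm m h) h = (\<Sum>j<m. coef h j * cnjg (coef h j))"
    unfolding Sm_def by (simp add: ip_sum_left ip_smul_left coef_def ip_commute[of "\<phi> _" h])
  also have "\<dots> = of_real (\<Sum>j<m. (norm (coef h j))\<^sup>2)"
    by (simp only: mult_cnjg_of_real of_real_sum)
  finally show ?thesis using l2norm_split[OF l2_coef, of h m] by simp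
qed

text \<open>The error splits into the distance from \<open>S\<inverse> f\<close> to the section space, which the
  coefficients of \<open>S\<inverse> (S\<inverse> f)\<close> control because they are the dual-frame coefficients of
  \<open>S\<inverse> f\<close>, and the part of the series for \<open>S (S\<inverse> f)\<close> beyond \<open>m\<close>.\<close>

lemma finite_section_error:
  fixes n m :: nat
  defines "M \<equiv> span (\<phi> ` {..<n})"
  defines "V \<equiv> \<lambda>h. orth_proj ip M (Sm m h)"
  assumes coercive: "\<And>h. h \<in> M \<Longrightarrow> (tail (coef h) m)\<^sup>2 \<le> A / 2 * (norm h)\<^sup>2"
    and h: "S h = f" and k: "S k = h"
  shows "bij_betw V M M"
    and "norm (h - inv_into M V (orth_proj ip M f))
      \<le> (1 + 2 * B / A) * sqrt B * tail (coef k) n + 2 / A * sqrt B * tail (coef h) m"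
proof -
  let ?P = "orth_proj ip M"
  have F: "finite (\<phi> ` {..<n})" "M = span (\<phi> ` {..<n})" by (simp_all add: M_def)
  note P = orth_proj_props[OF F]
  have energy: "A / 2 * (norm x)\<^sup>2 \<le> norm (ip (V x) x)" if x: "x \<in> M" for x
  proof -
    have "ip (V x) x = ip (Sm m x) x" using P(2)[OF x, of "Sm m x"] by (simp add: V_def ip_diff_left)
    then have "norm (ip (V x) x) = \<bar>(l2norm (coef x))\<^sup>2 - (tail (coef x) m)\<^sup>2\<bar>"
      by (simp only: ip_Sm_self norm_of_real)
    then show ?thesis
      using coef_lower[of x] coercive[OF x] abs_ge_self[of "(l2norm (coef x))\<^sup>2 - (tail (coef x) m)\<^sup>2"]
      by linarith
  qed
  show bij: "bij_betw V M M"
  proof (rule definite_imp_bij_betw[OF F])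
    show "V (x + y) = V x + V y" for x y by (simp add: V_def Sm_add orth_proj_add[OF F])
    show "V (smul a x) = smul a (V x)" for a x by (simp add: V_def Sm_smul orth_proj_smul[OF F])
    show "V x \<in> M" for x unfolding V_def by (rule P(1))
    show "x = 0" if "x \<in> M" "ip (V x) x = 0" for x
      using energy[OF that(1)] that(2) A_pos by (simp add: mult_le_0_iff)
  qed
  define z where "z = inv_into M V (?P f)"
  have "?P f \<in> V ` M" using P(1) bij by (simp add: bij_betw_def)
  then have z: "z \<in> M" "V z = ?P f" unfolding z_def by (auto intro: inv_into_into f_inv_into_f)
  have lower: "norm x \<le> 2 / A * norm (V x)" if x: "x \<in> M" for x
  proof (cases "x = 0")
    case False
    have "A / 2 * norm x * norm x \<le> norm (V x) * norm x"
      using energy[OF x] Cauchy_Schwarz[of "V x" x] by (simp add: power2_eq_square)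
    with False have "A / 2 * norm x \<le> norm (V x)" by simp
    then show ?thesis using A_pos by (simp add: field_simps)
  qed (use A_pos in simp)
  have Pz: "?P h - z \<in> M" using P(1) z(1) by (simp add: M_def span_diff)
  have dist: "norm (h - ?P h) \<le> sqrt B * tail (coef k) n"
  proof -
    have "Sm n k \<in> M" unfolding Sm_def M_def by (intro span_sum span_scale) (auto intro: span_base)
    then have "norm (h - ?P h) \<le> norm (h - Sm n k)" by (rule orth_proj_dist_le[OF F])
    with norm_S_minus_Sm_le[of k n] show ?thesis unfolding k by linarith
  qed
  have "V (?P h - z) = ?P (Sm m (?P h) - f)"
    unfolding V_def Sm_diff orth_proj_diff[OF F] using z(2) by (simp add: V_def)
  then have "norm (V (?P h - z)) \<le> norm (Sm m (?P h) - f)" using orth_proj_norm_le[OF F] by simp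
  also have "Sm m (?P h) - f = - Sm m (h - ?P h) - (S h - Sm m h)" by (simp add: Sm_diff h)
  also have "norm \<dots> \<le> norm (Sm m (h - ?P h)) + norm (S h - Sm m h)"
    by (metis norm_minus_cancel norm_triangle_ineq4)
  also have "\<dots> \<le> B * norm (h - ?P h) + sqrt B * tail (coef h) m"
    by (intro add_mono norm_Sm_le norm_S_minus_Sm_le)
  finally have V: "norm (V (?P h - z)) \<le> B * norm (h - ?P h) + sqrt B * tail (coef h) m" .
  have "norm (h - z) \<le> norm (h - ?P h) + norm (?P h - z)"
    using norm_triangle_ineq[of "h - ?P h" "?P h - z"] by simp
  also have "\<dots> \<le> norm (h - ?P h) + 2 / A * (B * norm (h - ?P h) + sqrt B * tail (coef h) m)"
    using lower[OF Pz] mult_left_mono[OF V, of "2 / A"] A_pos by simp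
  also have "\<dots> = (1 + 2 * B / A) * norm (h - ?P h) + 2 / A * sqrt B * tail (coef h) m"
    by (simp add: algebra_simps)
  also have "\<dots> \<le> (1 + 2 * B / A) * (sqrt B * tail (coef k) n) + 2 / A * sqrt B * tail (coef h) m"
    using A_pos B_pos by (intro add_mono mult_left_mono dist) auto
  finally show "norm (h - inv_into M V (?P f))
      \<le> (1 + 2 * B / A) * sqrt B * tail (coef k) n + 2 / A * sqrt B * tail (coef h) m"
    by (simp add: z_def mult.assoc)
qed

end

context localized_frame
begin

text \<open>This is the reason for the choice of \<open>m\<close>. The coefficients of \<open>h\<close> with respect to \<open>\<phi>\<close> have norm at
  most \<open>\<parallel>h\<parallel> / sqrt \<mu>\<close>, and each of the first \<open>n\<close> frame vectors has inner product at most
  \<open>c0 (j - n + 2) powr (- s)\<close> with \<open>\<phi> j\<close> for \<open>j \<ge> m\<close>; summation over \<open>j\<close> leaves at most half of the lower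
  frame bound.\<close>

lemma section_tail_bound:
  fixes n m :: nat
  assumes n: "n \<ge> 1" and gram: "\<mu> > 0"
      "\<And>c. \<mu> * (\<Sum>l<n. (norm (c l))\<^sup>2) \<le> (norm (lincomb \<phi> n c))\<^sup>2"
    and m: "real n + (2 * c0\<^sup>2 * real n / (A * (2 * s - 1) * \<mu>)) powr (1 / (2 * s - 1)) \<le> real m"
    and h: "h \<in> span (\<phi> ` {..<n})"
  shows "(tail (coef h) m)\<^sup>2 \<le> A / 2 * (norm h)\<^sup>2"
proof -
  define p where "p = 2 * s - 1"
  define X where "X = 2 * c0\<^sup>2 * real n / (A * p * \<mu>)"
  have p: "p > 0" using s_gt_1 by (simp add: p_def)
  have X: "X > 0" using n c0_pos A_pos gram(1) p by (simp add: X_def)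
  have mX: "real n + X powr (1 / p) \<le> real m" using m by (simp add: X_def p_def)
  then have mn: "real m > real n - 1" using powr_ge_zero[of X "1 / p"] by linarith
  have m_ge: "m \<ge> n" using mX powr_ge_zero[of X "1 / p"] by linarith
  obtain c where c: "h = lincomb \<phi> n c" using h unfolding span_eq_lincomb by blast
  define E where "E = (\<Sum>l<n. (norm (c l))\<^sup>2)"
  have E: "E \<ge> 0" by (simp add: E_def sum_nonneg)
  have pointwise: "(norm (coef h j))\<^sup>2 \<le> c0\<^sup>2 * real n * E * (1 + (real j - (real n - 1))) powr (- p - 1)"
    if j: "j \<ge> m" for j
  proof -
    let ?w = "c0 * (1 + (real j - (real n - 1))) powr (- s)"
    have "norm (ip (\<phi> l) (\<phi> j)) \<le> ?w" if l: "l < n" for l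
    proof -
      have "(1 + \<bar>real l - real j\<bar>) powr (- s) \<le> (1 + (real j - (real n - 1))) powr (- s)"
        using j m_ge l s_gt_1 by (intro powr_mono2') auto
      then have "c0 * (1 + \<bar>real l - real j\<bar>) powr (- s) \<le> ?w"
        using c0_pos by (intro mult_left_mono) auto
      with gram_decay[of l j] show ?thesis by linarith
    qed
    then have "norm (coef h j) \<le> (\<Sum>l<n. norm (c l) * ?w)"
      unfolding c coef_def lincomb_def ip_sum_left ip_smul_left
      by (intro sum_norm_le) (auto simp: norm_mult intro!: mult_left_mono)
    then have "(norm (coef h j))\<^sup>2 \<le> (\<Sum>l<n. norm (c l) * ?w)\<^sup>2" by (rule power_mono) simp
    also have "\<dots> \<le> (\<Sum>l<n. (norm (c l))\<^sup>2) * (\<Sum>l<n. ?w\<^sup>2)" by (rule Cauchy_Schwarz_ineq_sum)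
    also have "\<dots> = c0\<^sup>2 * real n * E * (1 + (real j - (real n - 1))) powr (- p - 1)"
      by (simp add: E_def power_mult_distrib powr_square p_def)
    finally show ?thesis .
  qed
  have "(real m - (real n - 1)) powr (- p) \<le> (X powr (1 / p)) powr (- p)"
    using mX X p by (intro powr_mono2') auto
  also have "\<dots> = 1 / X" using p X by (simp add: powr_powr powr_minus_divide)
  finally have mp: "(real m - (real n - 1)) powr (- p) \<le> 1 / X" .
  \<comment> \<open>\<open>X\<close> is exactly the number that makes this an identity.\<close>
  have bound: "c0\<^sup>2 * real n * E * (1 / X / p) = A / 2 * (\<mu> * E)"
    unfolding X_def using n c0_pos A_pos gram(1) p by (simp add: field_simps)
  have "l2norm (\<lambda>j. if m \<le> j then coef h j else 0) \<le> sqrt (A / 2 * (norm h)\<^sup>2)"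
  proof (rule l2_bounded(2))
    fix N
    have "(\<Sum>j<N. (norm (if m \<le> j then coef h j else 0))\<^sup>2) = (\<Sum>j=m..<N. (norm (coef h j))\<^sup>2)"
      by (rule sum.mono_neutral_cong_right) auto
    also have "\<dots> \<le> (\<Sum>j=m..<N. c0\<^sup>2 * real n * E * (1 + (real j - (real n - 1))) powr (- p - 1))"
      by (intro sum_mono pointwise) auto
    also have "\<dots> \<le> c0\<^sup>2 * real n * E * ((real m - (real n - 1)) powr (- p) / p)"
      unfolding sum_distrib_left[symmetric]
      using E by (intro mult_left_mono sum_powr_shift_le p mn) auto
    also have "\<dots> \<le> c0\<^sup>2 * real n * E * (1 / X / p)"
      using E p mp by (intro mult_left_mono divide_right_mono) auto
    also have "\<dots> \<le> A / 2 * (norm h)\<^sup>2"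
      unfolding bound using A_pos gram(2)[of c] unfolding c E_def by (intro mult_left_mono) auto
    finally show "L2_set (\<lambda>j. norm (if m \<le> j then coef h j else 0)) {..<N} \<le> sqrt (A / 2 * (norm h)\<^sup>2)"
      unfolding L2_set_def by (rule real_sqrt_le_mono)
  qed
  then have "tail (coef h) m \<le> sqrt (A / 2 * (norm h)\<^sup>2)" by (simp only: tail_def)
  then have "(tail (coef h) m)\<^sup>2 \<le> (sqrt (A / 2 * (norm h)\<^sup>2))\<^sup>2"
    by (rule power_mono) (rule tail_nonneg[OF l2_coef])
  then show ?thesis using A_pos by simp
qed

end

theorem theorem3p7:
  fixes smul :: "'k::hilbert_scalar \<Rightarrow> 'a::{banach, second_countable_topology} \<Rightarrow> 'a"
    and ip :: "'a \<Rightarrow> 'a \<Rightarrow> 'k"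
    and \<psi> :: "nat \<Rightarrow> 'a" and f :: 'a
    and A B c0 s c' :: real and m :: "nat \<Rightarrow> nat"
  assumes hilbert: "hilbert_space smul ip"
    and frame: "is_frame ip \<psi> A B"
    and gram_inv: "\<forall>n\<ge>1. invertible_mat (gram_matrix ip \<psi> n)"
    and c0: "c0 > 0" and s: "s > 1"
    and decay: "\<forall>j\<ge>1. \<forall>l\<ge>1. norm (ip (\<psi> j) (\<psi> l)) \<le> c0 * (1 + \<bar>real j - real l\<bar>) powr (- s)"
    and c': "c' > 0"
    and f_decay: "\<forall>j\<ge>1. norm (ip f (\<psi> j)) \<le> c' * real j powr (- s)"
    and m: "\<forall>n\<ge>1. m n = n + nat \<lceil>(2 * c0\<^sup>2 * real n /
              (A * (2 * s - 1) * lambda_min (gram_matrix ip \<psi> n))) powr (1 / (2 * s - 1))\<rceil>"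
  shows "\<exists>c>0. \<forall>n\<ge>1.
    bij_betw (section_operator smul ip \<psi> n (m n)) (section_space smul \<psi> n) (section_space smul \<psi> n) \<and>
    norm (inv_into UNIV (frame_operator smul ip \<psi>) f -
          inv_into (section_space smul \<psi> n) (section_operator smul ip \<psi> n (m n))
            (orth_proj ip (section_space smul \<psi> n) f))
      \<le> c * real n powr (- (s - 1 / 2))"
proof -
  define \<phi> where "\<phi> j = \<psi> (Suc j)" for j
  interpret hilbert_space smul ip by (rule hilbert)
  interpret localized_frame smul ip \<phi> A B c0 s
  proof unfold_locales
    show "norm (ip (\<phi> j) (\<phi> l)) \<le> c0 * (1 + \<bar>real j - real l\<bar>) powr (- s)" for j l
      using decay[rule_format, of "Suc j" "Suc l"] by (simp add: \<phi>_def)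
  qed (use frame c0 s in \<open>auto simp: is_frame_def \<phi>_def\<close>)
  have S_eq: "frame_operator smul ip \<psi> = S"
    by (simp add: fun_eq_iff frame_operator_def S_def syn_def coef_def \<phi>_def)
  have Sm_eq: "partial_frame_operator smul ip \<psi> n = Sm n" for n
    by (simp add: fun_eq_iff partial_frame_operator_def Sm_def coef_def \<phi>_def sum.atLeast1_atMost_eq)
  have M_eq: "section_space smul \<psi> n = span (\<phi> ` {..<n})" for n
  proof -
    have "\<psi> ` {1..n} = \<psi> ` Suc ` {..<n}" by (simp add: image_Suc_lessThan)
    then show ?thesis unfolding section_space_def by (simp add: image_image \<phi>_def)
  qed
  have V_eq: "section_operator smul ip \<psi> n k = (\<lambda>h. orth_proj ip (span (\<phi> ` {..<n})) (Sm k h))" for n k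
    by (simp add: fun_eq_iff section_operator_def M_eq Sm_eq)
  have gram_eq: "gram_matrix ip \<psi> n = Matrix.mat n n (\<lambda>(j, l). ip (\<phi> j) (\<phi> l))" for n
    by (simp add: gram_matrix_def \<phi>_def)

  \<comment> \<open>The iterated preimages of \<open>f\<close>: \<open>g 1\<close> is the solution, and the coefficients of \<open>g 2\<close> are those of
    the canonical expansion of \<open>g 1\<close> in the frame.\<close>
  define g where "g i = rec_nat f (\<lambda>_. inv_into UNIV S) i" for i
  have Sg: "S (g (Suc i)) = g i" for i by (simp add: g_def surj_f_inv_f[OF S_surj])
  have "tail_decay (s - 1 / 2) (coef (g 0))"
  proof (rule tail_decay_of_pointwise[OF l2_coef])
    show "norm (coef (g 0) j) \<le> c' * (1 + real j) powr (- s)" for j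
      using f_decay[rule_format, of "Suc j"] by (simp add: g_def coef_def \<phi>_def)
  qed (use s c' in auto)
  then have dec: "tail_decay (s - 1 / 2) (coef (g i))" for i
    by (rule tail_decay_inverse_frame_operator[where g = g, OF Sg])
  obtain C1 where C1: "C1 \<ge> 0" "\<And>N. N \<ge> 1 \<Longrightarrow> tail (coef (g 1)) N \<le> C1 * real N powr (- (s - 1 / 2))"
    using dec[of 1] unfolding tail_decay_def by blast
  obtain C2 where C2: "C2 \<ge> 0" "\<And>N. N \<ge> 1 \<Longrightarrow> tail (coef (g 2)) N \<le> C2 * real N powr (- (s - 1 / 2))"
    using dec[of 2] unfolding tail_decay_def by blast
  define K where "K = (1 + 2 * B / A) * sqrt B * C2 + 2 / A * sqrt B * C1 + 1"
  have K: "K > 0"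
    unfolding K_def using A_pos B_pos C1(1) C2(1) by (intro add_nonneg_pos add_nonneg_nonneg) auto
  have "bij_betw (section_operator smul ip \<psi> n (m n)) (section_space smul \<psi> n) (section_space smul \<psi> n) \<and>
    norm (inv_into UNIV (frame_operator smul ip \<psi>) f -
          inv_into (section_space smul \<psi> n) (section_operator smul ip \<psi> n (m n))
            (orth_proj ip (section_space smul \<psi> n) f)) \<le> K * real n powr (- (s - 1 / 2))"
    if n: "n \<ge> 1" for n
  proof -
    let ?l = "lambda_min (gram_matrix ip \<psi> n)" and ?r = "real n powr (- (s - 1 / 2))"
    have inv: "invertible_mat (gram_matrix ip \<psi> n)" using gram_inv n by blast
    note gram = gram_lambda_min[OF n inv[unfolded gram_eq], folded gram_eq]
    have "real n + (2 * c0\<^sup>2 * real n / (A * (2 * s - 1) * ?l)) powr (1 / (2 * s - 1)) \<le> real (m n)"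
      using m n by (simp add: real_nat_ceiling_ge)
    note coercive = section_tail_bound[OF n gram this]
    have S12: "S (g 1) = f" "S (g 2) = g 1"
      using Sg[of 0] Sg[of 1] by (simp_all add: g_def numeral_2_eq_2)
    note err = finite_section_error[OF coercive S12]
    have "tail (coef (g 1)) (m n) \<le> tail (coef (g 1)) n"
      using m n by (intro tail_mono l2_coef) simp
    also have "\<dots> \<le> C1 * ?r" by (rule C1(2)[OF n])
    finally have t1: "tail (coef (g 1)) (m n) \<le> C1 * ?r" .
    have "(1 + 2 * B / A) * sqrt B * tail (coef (g 2)) n + 2 / A * sqrt B * tail (coef (g 1)) (m n)
        \<le> (1 + 2 * B / A) * sqrt B * (C2 * ?r) + 2 / A * sqrt B * (C1 * ?r)"
      using A_pos B_pos by (intro add_mono mult_left_mono t1 C2(2) n) auto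
    also have "\<dots> \<le> K * ?r" by (simp add: K_def algebra_simps)
    finally have "(1 + 2 * B / A) * sqrt B * tail (coef (g 2)) n
        + 2 / A * sqrt B * tail (coef (g 1)) (m n) \<le> K * ?r" .
    then show ?thesis
      unfolding S_eq M_eq V_eq using err(1) order_trans[OF err(2)] by (simp add: g_def)
  qed
  with K show ?thesis by blast
qed

end
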